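(* Let $R$ be an indecomposable commutative ring and let $(\Sigma,i,q)$ be a discrete $R$-twist over an ample Hausdorff groupoid $G$. Let $\mathcal I$ denote the interior of the isotropy in $G$ and let $\mathcal J=q^{-1}(\mathcal I)$, which is the interior of the isotropy in $\Sigma$. For each $x\in G^{(0)}$, let $\mathcal I_x=\{\gamma\in\mathcal I:s(\gamma)=x\}$ and let $c_x$ be the normalised $2$-cocycle on the group $\mathcal I_x$ determined by a choice of unit-preserving section $\zeta\colon\mathcal I_x\to\mathcal J_x$ for $q$. Suppose that the set of units $x\in G^{(0)}$ for which the unit group of the twisted group ring is $R(\mathcal I_x,c_x)^\times=\{t\delta_\alpha:t\in R^\times\text{ and }\alpha\in\mathcal I_x\}$ is dense in $G^{(0)}$. Then the twist $(\mathcal J,i,q|_{\mathcal J})$ over $\mathcal I$ satisfies the local bisection hypothesis.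
   Context: **Rings and groupoids.** A commutative ring $R$ with identity is indecomposable if its only idempotents are $0$ and $1$. $R^\times$ is its group of units, with the discrete topology. Groupoids are locally compact topological groupoids with Hausdorff unit space $G^{(0)}$ and range/source maps $r,s$. A bisection is a subset $D$ contained in an open set $O$ such that $r|_O,s|_O$ are homeomorphisms onto open subsets of $G^{(0)}$. $G$ is étale if $r$ is a local homeomorphism, and ample if it is étale with a basis of compact open bisections. The isotropy of $G$ is $\{\gamma\in G:r(\gamma)=s(\gamma)\}$. **Twists.** A discrete $R$-twist $(\Sigma,i,q)$ over an étale groupoid $G$ is a sequence $G^{(0)}\times R^\times\xrightarrow{i}\Sigma\xrightarrow{q}G$, where $G^{(0)}\times R^\times$ is the trivial group bundle, $\Sigma$ is a topological groupoid with $\Sigma^{(0)}=i(G^{(0)}\times\{1\})$ (identified with $G^{(0)}$), and $i,q$ are continuous groupoid homomorphisms restricting to homeomorphisms of unit spaces, such that: (DT1) $i(\{x\}\times R^\times)=q^{-1}(x)$ for $x\in G^{(0)}$, $i$ injective, $q$ surjective; (DT2) each $\alpha\in G$ has an open bisection $B_\alpha\ni\alpha$ and a continuous $P_\alpha\colon B_\alpha\to\Sigma$ with $q\circ P_\alpha=\mathrm{id}$ and $(\beta,t)\mapsto i(r(\beta),t)P_\alpha(\beta)$ a homeomorphism $B_\alpha\times R^\times\to q^{-1}(B_\alpha)$; (DT3) $i(r(\sigma),t)\sigma=\sigma i(s(\sigma),t)$. Write $t\cdot\sigma=i(r(\sigma),t)\sigma$. With $\mathcal I,\mathcal J$ as in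 the claim, $(\mathcal J,i,q|_{\mathcal J})$ is a discrete $R$-twist over $\mathcal I$. **Twisted group rings.** For $x\in G^{(0)}$, $\mathcal J_x=\{\sigma\in\mathcal J:s(\sigma)=x\}$. Choose a section $\zeta\colon\mathcal I_x\to\mathcal J_x$ of $q|_{\mathcal J_x}$ with $\zeta(x)=x$; $c_x\colon\mathcal I_x\times\mathcal I_x\to R^\times$ is defined by $\zeta(\alpha)\zeta(\beta)=c_x(\alpha,\beta)\cdot\zeta(\alpha\beta)$, and is a normalised $2$-cocycle (the condition below does not depend on $\zeta$). For a group $H$ and normalised $2$-cocycle $c\colon H\times H\to R^\times$, $R(H,c)$ is the $R$-algebra of finitely supported functions $H\to R$ with product $(f*g)(\beta)=\sum_{\alpha\in H}c(\alpha,\alpha^{-1}\beta)f(\alpha)g(\alpha^{-1}\beta)$; $\delta_\alpha$ are the point masses. **Twisted Steinberg algebra and local bisection hypothesis.** $\operatorname{supp}(f)=\{f\neq0\}$, $\operatorname{supp}_G(f)=q(\operatorname{supp}(f))$. For a discrete $R$-twist $(\Sigma,i,q)$ over an ample Hausdorff groupoid $G$, $A_R(G;\Sigma)$ is the set of locally constant $f\colon\Sigma\to R$ with $f(t\cdot\sigma)=t^{-1}f(\sigma)$ for $t\in R^\times$ and $q(\operatorname{supp}(f))$ compact; it is an $R$-algebra under pointwise operations and $(f*g)(\sigma)=\sum_{\alpha\in r^{-1}(r(\sigma))\cap\operatorname{supp}_G(f)}f(S(\alpha))g(S(\alpha)^{-1}\sigma)$, with $S\colon\operatorname{supp}_G(f)\to\operatorname{supp}(f)$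 any section for $q$. $B=A_R(G^{(0)};q^{-1}(G^{(0)}))$ is the commutative subalgebra of those $f$ supported in $q^{-1}(G^{(0)})$. A normaliser of $B$ in $A=A_R(G;\Sigma)$ is $n\in A$ for which there is $k\in A$ with $knk=k$, $nkn=n$, $kBn\cup nBk\subseteq B$. The twist satisfies the local bisection hypothesis if $\operatorname{supp}_G(n)$ is a bisection of $G$ for every normaliser $n$ of $B$ in $A$; for the twist $(\mathcal J,i,q|_{\mathcal J})$ this is applied with $\mathcal I,\mathcal J$ in place of $G,\Sigma$. *)

theory Defs
  imports "HOL-Analysis.Abstract_Topological_Spaces" "HOL-Algebra.Ring"
begin

section \<open>Topological groupoids\<close>

text \<open>The set of arrows is the topological space \<open>topspace (gtop G)\<close>; units are particular arrows.
  The product \<open>gmult G a b\<close> is meaningful when \<open>src G a = rng G b\<close>.\<close>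

record 'g tgroupoid =
  gtop :: "'g topology"
  rng :: "'g \<Rightarrow> 'g"
  src :: "'g \<Rightarrow> 'g"
  gmult :: "'g \<Rightarrow> 'g \<Rightarrow> 'g"
  ginv :: "'g \<Rightarrow> 'g"

abbreviation arrows :: "'g tgroupoid \<Rightarrow> 'g set" where
  "arrows G \<equiv> topspace (gtop G)"

definition units :: "'g tgroupoid \<Rightarrow> 'g set" where
  "units G = src G ` arrows G"

definition unit_space :: "'g tgroupoid \<Rightarrow> 'g topology" where
  "unit_space G = subtopology (gtop G) (units G)"

definition composable :: "'g tgroupoid \<Rightarrow> ('g \<times> 'g) set" where
  "composable G = {(a, b). a \<in> arrows G \<and> b \<in> arrows G \<and> src G a = rng G b}"

locale topological_groupoid =
  fixes G :: "'g tgroupoid"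
  assumes src_closed: "a \<in> arrows G \<Longrightarrow> src G a \<in> arrows G"
    and rng_closed: "a \<in> arrows G \<Longrightarrow> rng G a \<in> arrows G"
    and src_src: "a \<in> arrows G \<Longrightarrow> src G (src G a) = src G a"
    and rng_src: "a \<in> arrows G \<Longrightarrow> rng G (src G a) = src G a"
    and src_rng: "a \<in> arrows G \<Longrightarrow> src G (rng G a) = rng G a"
    and rng_rng: "a \<in> arrows G \<Longrightarrow> rng G (rng G a) = rng G a"
    and mult_closed: "(a, b) \<in> composable G \<Longrightarrow> gmult G a b \<in> arrows G"
    and src_mult: "(a, b) \<in> composable G \<Longrightarrow> src G (gmult G a b) = src G b"
    and rng_mult: "(a, b) \<in> composable G \<Longrightarrow> rng G (gmult G a b) = rng G a"
    and mult_assoc: "(a, b) \<in> composable G \<Longrightarrow> (b, c) \<in> composable G \<Longrightarrow>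
          gmult G (gmult G a b) c = gmult G a (gmult G b c)"
    and rng_mult_left: "a \<in> arrows G \<Longrightarrow> gmult G (rng G a) a = a"
    and src_mult_right: "a \<in> arrows G \<Longrightarrow> gmult G a (src G a) = a"
    and inv_closed: "a \<in> arrows G \<Longrightarrow> ginv G a \<in> arrows G"
    and src_inv: "a \<in> arrows G \<Longrightarrow> src G (ginv G a) = rng G a"
    and rng_inv: "a \<in> arrows G \<Longrightarrow> rng G (ginv G a) = src G a"
    and mult_inv_right: "a \<in> arrows G \<Longrightarrow> gmult G a (ginv G a) = rng G a"
    and mult_inv_left: "a \<in> arrows G \<Longrightarrow> gmult G (ginv G a) a = src G a"
    and continuous_mult: "continuous_map
          (subtopology (prod_topology (gtop G) (gtop G)) (composable G)) (gtop G)
          (\<lambda>(a, b). gmult G a b)"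
    and continuous_inv: "continuous_map (gtop G) (gtop G) (ginv G)"

definition bisection :: "'g tgroupoid \<Rightarrow> 'g set \<Rightarrow> bool" where
  "bisection G D \<longleftrightarrow> (\<exists>V. openin (gtop G) V \<and> D \<subseteq> V \<and>
     openin (unit_space G) (rng G ` V) \<and>
     homeomorphic_map (subtopology (gtop G) V) (subtopology (unit_space G) (rng G ` V)) (rng G) \<and>
     openin (unit_space G) (src G ` V) \<and>
     homeomorphic_map (subtopology (gtop G) V) (subtopology (unit_space G) (src G ` V)) (src G))"

definition local_homeomorphism :: "'a topology \<Rightarrow> 'b topology \<Rightarrow> ('a \<Rightarrow> 'b) \<Rightarrow> bool" where
  "local_homeomorphism X Y h \<longleftrightarrow> (\<forall>x\<in>topspace X. \<exists>V. openin X V \<and> x \<in> V \<and>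
     openin Y (h ` V) \<and> homeomorphic_map (subtopology X V) (subtopology Y (h ` V)) h)"

locale etale_groupoid = topological_groupoid +
  assumes locally_compact: "locally_compact_space (gtop G)"
    and Hausdorff_units: "Hausdorff_space (unit_space G)"
    and local_homeo_rng: "local_homeomorphism (gtop G) (unit_space G) (rng G)"

locale ample_groupoid = etale_groupoid +
  assumes compact_open_bisection_basis:
    "openin (gtop G) U \<Longrightarrow> a \<in> U \<Longrightarrow>
       \<exists>K. compactin (gtop G) K \<and> openin (gtop G) K \<and> bisection G K \<and> a \<in> K \<and> K \<subseteq> U"

definition isotropy :: "'g tgroupoid \<Rightarrow> 'g set" where
  "isotropy G = {a \<in> arrows G. rng G a = src G a}"

definition restrict_groupoid :: "'g tgroupoid \<Rightarrow> 'g set \<Rightarrow> 'g tgroupoid" where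
  "restrict_groupoid G S = G\<lparr>gtop := subtopology (gtop G) S\<rparr>"

definition groupoid_hom :: "'g tgroupoid \<Rightarrow> 'h tgroupoid \<Rightarrow> ('g \<Rightarrow> 'h) \<Rightarrow> bool" where
  "groupoid_hom G H h \<longleftrightarrow>
     h \<in> arrows G \<rightarrow> arrows H \<and>
     (\<forall>a\<in>arrows G. rng H (h a) = h (rng G a) \<and> src H (h a) = h (src G a)) \<and>
     (\<forall>(a, b)\<in>composable G. h (gmult G a b) = gmult H (h a) (h b))"


section \<open>Discrete twists\<close>

definition runits :: "'r::comm_ring_1 set" where
  "runits = {t. t dvd 1}"

definition trivial_bundle :: "'g tgroupoid \<Rightarrow> ('g \<times> 'r::comm_ring_1) tgroupoid" where
  "trivial_bundle G =
    \<lparr>gtop = prod_topology (unit_space G) (discrete_topology runits),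
     rng = (\<lambda>(x, t). (x, 1)), src = (\<lambda>(x, t). (x, 1)),
     gmult = (\<lambda>(x, t) (y, u). (x, t * u)),
     ginv = (\<lambda>(x, t). (x, THE u. t * u = 1))\<rparr>"

text \<open>The unit spaces of \<open>\<Sigma>\<close> and \<open>G\<close> are different sets, identified via \<open>x \<mapsto> i (x, 1)\<close>, whose inverse
  is the restriction of \<open>q\<close>. Hence a unit of \<open>\<Sigma>\<close> used as an argument of \<open>i\<close> is first mapped by \<open>q\<close>.\<close>

definition twist_act ::
    "'s tgroupoid \<Rightarrow> ('g \<times> 'r::comm_ring_1 \<Rightarrow> 's) \<Rightarrow> ('s \<Rightarrow> 'g) \<Rightarrow> 'r \<Rightarrow> 's \<Rightarrow> 's" where
  "twist_act \<Sigma> i q t \<sigma> = gmult \<Sigma> (i (q (rng \<Sigma> \<sigma>), t)) \<sigma>"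

locale discrete_twist =
  G: etale_groupoid G + \<Sigma>: topological_groupoid \<Sigma>
  for G :: "'g tgroupoid" and \<Sigma> :: "'s tgroupoid" +
  fixes i :: "'g \<times> 'r::comm_ring_1 \<Rightarrow> 's" and q :: "'s \<Rightarrow> 'g"
  assumes continuous_i: "continuous_map (gtop (trivial_bundle G :: ('g \<times> 'r) tgroupoid)) (gtop \<Sigma>) i"
    and hom_i: "groupoid_hom (trivial_bundle G) \<Sigma> i"
    and units_i: "units \<Sigma> = i ` (units G \<times> {1})"
    and unit_homeo_i: "homeomorphic_map (unit_space (trivial_bundle G)) (unit_space \<Sigma>) i"
    and continuous_q: "continuous_map (gtop \<Sigma>) (gtop G) q"
    and hom_q: "groupoid_hom \<Sigma> G q"
    and unit_homeo_q: "homeomorphic_map (unit_space \<Sigma>) (unit_space G) q"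
    and exact: "x \<in> units G \<Longrightarrow> i ` ({x} \<times> runits) = {\<sigma> \<in> arrows \<Sigma>. q \<sigma> = x}"
    and inj_i: "inj_on i (units G \<times> runits)"
    and surj_q: "q ` arrows \<Sigma> = arrows G"
    and local_trivialisation: "\<alpha> \<in> arrows G \<Longrightarrow>
      \<exists>D P. openin (gtop G) D \<and> bisection G D \<and> \<alpha> \<in> D \<and>
        continuous_map (subtopology (gtop G) D) (gtop \<Sigma>) P \<and> (\<forall>\<beta>\<in>D. q (P \<beta>) = \<beta>) \<and>
        homeomorphic_map (prod_topology (subtopology (gtop G) D) (discrete_topology runits))
          (subtopology (gtop \<Sigma>) {\<sigma> \<in> arrows \<Sigma>. q \<sigma> \<in> D})
          (\<lambda>(\<beta>, t). gmult \<Sigma> (i (rng G \<beta>, t)) (P \<beta>))"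
    and central: "\<sigma> \<in> arrows \<Sigma> \<Longrightarrow> t \<in> runits \<Longrightarrow>
      gmult \<Sigma> (i (q (rng \<Sigma> \<sigma>), t)) \<sigma> = gmult \<Sigma> \<sigma> (i (q (src \<Sigma> \<sigma>), t))"

text \<open>These are \<open>\<I>\<close> and its preimage \<open>\<J>\<close>; \<open>\<J>\<close> is then also the interior of the isotropy of \<open>\<Sigma>\<close>.\<close>

definition isotropy_interior :: "'g tgroupoid \<Rightarrow> 'g tgroupoid" where
  "isotropy_interior G = restrict_groupoid G (gtop G interior_of isotropy G)"

definition isotropy_twist :: "'g tgroupoid \<Rightarrow> 's tgroupoid \<Rightarrow> ('s \<Rightarrow> 'g) \<Rightarrow> 's tgroupoid" where
  "isotropy_twist G \<Sigma> q =
     restrict_groupoid \<Sigma> {\<sigma> \<in> arrows \<Sigma>. q \<sigma> \<in> arrows (isotropy_interior G)}"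


section \<open>Twisted group rings\<close>

text \<open>Normalisation of \<open>c\<close> makes the point mass at the identity a multiplicative identity. The sum defining
  the product is restricted to the finitely many \<open>\<alpha>\<close> with \<open>f \<alpha> \<noteq> 0\<close>, since \<open>sum\<close> is \<open>0\<close> on
  infinite sets.\<close>

definition point_mass :: "'h \<Rightarrow> 'r::comm_ring_1 \<Rightarrow> 'h \<Rightarrow> 'r" where
  "point_mass \<alpha> t = (\<lambda>\<beta>. if \<beta> = \<alpha> then t else 0)"

definition twisted_group_ring ::
    "'h monoid \<Rightarrow> ('h \<Rightarrow> 'h \<Rightarrow> 'r::comm_ring_1) \<Rightarrow> ('h \<Rightarrow> 'r) ring" where
  "twisted_group_ring H c =
    \<lparr>carrier = {f. finite {\<alpha>. f \<alpha> \<noteq> 0} \<and> {\<alpha>. f \<alpha> \<noteq> 0} \<subseteq> carrier H},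
     mult = (\<lambda>f g \<beta>. if \<beta> \<in> carrier H
               then \<Sum>\<alpha> \<in> {\<alpha> \<in> carrier H. f \<alpha> \<noteq> 0}.
                 c \<alpha> (inv\<^bsub>H\<^esub> \<alpha> \<otimes>\<^bsub>H\<^esub> \<beta>) * f \<alpha> * g (inv\<^bsub>H\<^esub> \<alpha> \<otimes>\<^bsub>H\<^esub> \<beta>)
               else 0),
     one = point_mass \<one>\<^bsub>H\<^esub> 1,
     zero = (\<lambda>\<beta>. 0),
     add = (\<lambda>f g \<beta>. f \<beta> + g \<beta>)\<rparr>"

text \<open>The fibre over a unit \<open>x\<close>; it is a group when all arrows of the groupoid lie in the isotropy.\<close>

definition fibre_group :: "'g tgroupoid \<Rightarrow> 'g \<Rightarrow> 'g monoid" where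
  "fibre_group K x = \<lparr>carrier = {\<gamma> \<in> arrows K. src K \<gamma> = x}, mult = gmult K, one = x\<rparr>"

definition unit_preserving_section ::
    "'g tgroupoid \<Rightarrow> 's tgroupoid \<Rightarrow> ('g \<times> 'r::comm_ring_1 \<Rightarrow> 's) \<Rightarrow> ('s \<Rightarrow> 'g) \<Rightarrow> 'g \<Rightarrow> ('g \<Rightarrow> 's) \<Rightarrow> bool" where
  "unit_preserving_section K L i q x \<zeta> \<longleftrightarrow>
     (\<forall>\<alpha>\<in>carrier (fibre_group K x).
        \<zeta> \<alpha> \<in> arrows L \<and> q (src L (\<zeta> \<alpha>)) = x \<and> q (\<zeta> \<alpha>) = \<alpha>) \<and>
     \<zeta> x = i (x, 1)"

definition cocycle_of_section ::
    "'g tgroupoid \<Rightarrow> 's tgroupoid \<Rightarrow> ('g \<times> 'r::comm_ring_1 \<Rightarrow> 's) \<Rightarrow> ('s \<Rightarrow> 'g) \<Rightarrow> 'g \<Rightarrow>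
      ('g \<Rightarrow> 's) \<Rightarrow> ('g \<Rightarrow> 'g \<Rightarrow> 'r) \<Rightarrow> bool" where
  "cocycle_of_section K L i q x \<zeta> c \<longleftrightarrow>
     (\<forall>\<alpha>\<in>carrier (fibre_group K x). \<forall>\<beta>\<in>carrier (fibre_group K x).
        c \<alpha> \<beta> \<in> runits \<and>
        gmult L (\<zeta> \<alpha>) (\<zeta> \<beta>) = twist_act L i q (c \<alpha> \<beta>) (\<zeta> (gmult K \<alpha> \<beta>)))"


section \<open>Twisted Steinberg algebras and the local bisection hypothesis\<close>

definition supp :: "('s \<Rightarrow> 'r::comm_ring_1) \<Rightarrow> 's set" where
  "supp f = {\<sigma>. f \<sigma> \<noteq> 0}"

text \<open>Functions on \<open>\<Sigma>\<close> are represented by their extensions by \<open>0\<close> to the whole type.\<close>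

definition steinberg_algebra ::
    "'g tgroupoid \<Rightarrow> 's tgroupoid \<Rightarrow> ('g \<times> 'r::comm_ring_1 \<Rightarrow> 's) \<Rightarrow> ('s \<Rightarrow> 'g) \<Rightarrow> ('s \<Rightarrow> 'r) set" where
  "steinberg_algebra G \<Sigma> i q =
    {f. supp f \<subseteq> arrows \<Sigma> \<and>
        (\<forall>\<sigma>\<in>arrows \<Sigma>. \<exists>V. openin (gtop \<Sigma>) V \<and> \<sigma> \<in> V \<and> (\<forall>\<tau>\<in>V. f \<tau> = f \<sigma>)) \<and>
        (\<forall>\<sigma>\<in>arrows \<Sigma>. \<forall>t u. t * u = 1 \<longrightarrow> f (twist_act \<Sigma> i q t \<sigma>) = u * f \<sigma>) \<and>
        compactin (gtop G) (q ` supp f)}"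

text \<open>\<open>inv_into (supp f) q\<close> is a section of \<open>q\<close> over \<open>q ` supp f\<close> with values in \<open>supp f\<close>;
  the product does not depend on which one is used.\<close>

definition steinberg_mult ::
    "'g tgroupoid \<Rightarrow> 's tgroupoid \<Rightarrow> ('s \<Rightarrow> 'g) \<Rightarrow> ('s \<Rightarrow> 'r::comm_ring_1) \<Rightarrow> ('s \<Rightarrow> 'r) \<Rightarrow> 's \<Rightarrow> 'r" where
  "steinberg_mult G \<Sigma> q f g = (\<lambda>\<sigma>.
     let S = inv_into (supp f) q in
     if \<sigma> \<in> arrows \<Sigma>
     then \<Sum>\<alpha> \<in> {\<alpha> \<in> arrows G. rng G \<alpha> = q (rng \<Sigma> \<sigma>)} \<inter> q ` supp f.
            f (S \<alpha>) * g (gmult \<Sigma> (ginv \<Sigma> (S \<alpha>)) \<sigma>)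
     else 0)"

definition diagonal_subalgebra ::
    "'g tgroupoid \<Rightarrow> 's tgroupoid \<Rightarrow> ('g \<times> 'r::comm_ring_1 \<Rightarrow> 's) \<Rightarrow> ('s \<Rightarrow> 'g) \<Rightarrow> ('s \<Rightarrow> 'r) set" where
  "diagonal_subalgebra G \<Sigma> i q =
    {f \<in> steinberg_algebra G \<Sigma> i q. supp f \<subseteq> {\<sigma> \<in> arrows \<Sigma>. q \<sigma> \<in> units G}}"

definition normaliser ::
    "'g tgroupoid \<Rightarrow> 's tgroupoid \<Rightarrow> ('g \<times> 'r::comm_ring_1 \<Rightarrow> 's) \<Rightarrow> ('s \<Rightarrow> 'g) \<Rightarrow> ('s \<Rightarrow> 'r) \<Rightarrow> bool" where
  "normaliser G \<Sigma> i q n \<longleftrightarrow>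
    (let A = steinberg_algebra G \<Sigma> i q; B = diagonal_subalgebra G \<Sigma> i q;
         prd = steinberg_mult G \<Sigma> q
     in n \<in> A \<and> (\<exists>k\<in>A. prd (prd k n) k = k \<and> prd (prd n k) n = n \<and>
          (\<forall>b\<in>B. prd (prd k b) n \<in> B \<and> prd (prd n b) k \<in> B)))"

definition local_bisection_hypothesis ::
    "'g tgroupoid \<Rightarrow> 's tgroupoid \<Rightarrow> ('g \<times> 'r::comm_ring_1 \<Rightarrow> 's) \<Rightarrow> ('s \<Rightarrow> 'g) \<Rightarrow> bool" where
  "local_bisection_hypothesis G \<Sigma> i q \<longleftrightarrow>
    (\<forall>n. normaliser G \<Sigma> i q n \<longrightarrow> bisection G (q ` supp n))"

end

theory Submission
  imports Defs
begin

text \<open>Let \<open>n\<close> be a normaliser with partner \<open>k\<close>, in the twisted Steinberg algebra of \<open>\<J>\<close> over \<open>\<I>\<close>. The set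
  \<open>q ` supp n\<close> is compact and open, and on \<open>\<I>\<close> the range and source maps agree. Therefore
  \<open>q ` supp n\<close> is a bisection as soon as the local homeomorphism \<open>rng\<close> is injective on it, that is, as
  soon as it meets each isotropy group \<open>\<I>\<^sub>x\<close> in at most one arrow (\<open>bisection_isotropy_interior\<close>).

  Restriction to the fibre over \<open>x\<close>, along the section that defines the cocycle, is multiplicative from
  the Steinberg algebra to the twisted group ring of \<open>\<I>\<^sub>x\<close> (\<open>fibre_evaluation_mult\<close>), and it maps the
  diagonal to multiples of the identity. Inserting the indicator function of a compact open set of
  units (\<open>local_right_identity\<close>) shows that \<open>n \<star> k\<close> and \<open>k \<star> n\<close> are diagonal. Their values
  at \<open>x\<close> are idempotents of \<open>R\<close>, so they are \<open>0\<close> or \<open>1\<close>, and \<open>n\<close> either vanishes on the fibre over \<open>x\<close> or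
  restricts to a unit of the twisted group ring (\<open>normaliser_fibre_dichotomy\<close>). For \<open>x\<close> in the given
  dense set a unit is supported at a single arrow. Since \<open>q ` supp n\<close> is open and \<open>G\<close> is Hausdorff, two
  arrows of it over one unit would produce two arrows over every unit of a nonempty open set, and
  this set meets the dense set.

  The topological input is that \<open>q\<close> is open, that the unit space is open in \<open>G\<close>, that the sheets
  \<open>i ` (U \<times> {t})\<close> are open in \<open>\<Sigma>\<close> (so that indicator functions are locally constant), and that the
  interior of the isotropy is closed under division (so that \<open>\<I>\<^sub>x\<close> is a group and the cocycle formula
  applies inside it).\<close>

section \<open>Cancellation in groupoids\<close>

context topological_groupoid
begin

lemma unitsD:
  assumes "x \<in> units G" shows "x \<in> arrows G" "src G x = x" "rng G x = x"
  using assms src_closed src_src rng_src by (auto simp: units_def)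

lemma src_in_units: "a \<in> arrows G \<Longrightarrow> src G a \<in> units G"
  by (auto simp: units_def)

lemma rng_in_units: "a \<in> arrows G \<Longrightarrow> rng G a \<in> units G"
  by (metis rng_closed src_in_units src_rng)

lemma mult_inv_cancel_left:
  assumes "a \<in> arrows G" "b \<in> arrows G" "src G a = rng G b"
  shows "gmult G (ginv G a) (gmult G a b) = b"
proof -
  have "gmult G (gmult G (ginv G a) a) b = gmult G (ginv G a) (gmult G a b)"
    by (rule mult_assoc) (use assms src_inv inv_closed in \<open>auto simp: composable_def\<close>)
  then show ?thesis
    using assms mult_inv_left rng_mult_left by metis
qed

lemma mult_cancel_inv_left:
  assumes "a \<in> arrows G" "b \<in> arrows G" "rng G a = rng G b"
  shows "gmult G a (gmult G (ginv G a) b) = b"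
proof -
  have "gmult G (gmult G a (ginv G a)) b = gmult G a (gmult G (ginv G a) b)"
    by (rule mult_assoc) (use assms src_inv rng_inv inv_closed in \<open>auto simp: composable_def\<close>)
  then show ?thesis
    using assms mult_inv_right rng_mult_left by metis
qed

lemma left_division:
  assumes "a \<in> arrows G" "b \<in> arrows G" "rng G a = rng G b"
  shows "gmult G (ginv G a) b \<in> arrows G"
    "rng G (gmult G (ginv G a) b) = src G a" "src G (gmult G (ginv G a) b) = src G b"
proof -
  have "(ginv G a, b) \<in> composable G"
    using assms src_inv inv_closed by (auto simp: composable_def)
  then show "gmult G (ginv G a) b \<in> arrows G"
    "rng G (gmult G (ginv G a) b) = src G a" "src G (gmult G (ginv G a) b) = src G b"
    using mult_closed rng_mult src_mult rng_inv assms by auto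
qed

lemma continuous_map_mult:
  assumes "continuous_map X (gtop G) f" "continuous_map X (gtop G) g"
    and "\<And>x. x \<in> topspace X \<Longrightarrow> src G (f x) = rng G (g x)"
  shows "continuous_map X (gtop G) (\<lambda>x. gmult G (f x) (g x))"
proof -
  have "continuous_map X (subtopology (prod_topology (gtop G) (gtop G)) (composable G)) (\<lambda>x. (f x, g x))"
    using assms continuous_map_image_subset_topspace
    by (fastforce simp: continuous_map_in_subtopology continuous_map_pairedI composable_def)
  from continuous_map_compose[OF this continuous_mult] show ?thesis
    by (simp add: o_def)
qed

lemma continuous_rng: "continuous_map (gtop G) (gtop G) (rng G)"
proof -
  have "continuous_map (gtop G) (gtop G) (\<lambda>a. gmult G a (ginv G a))"
    by (intro continuous_map_mult continuous_inv) (auto simp: rng_inv)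
  then show ?thesis
    by (rule continuous_map_eq) (simp add: mult_inv_right)
qed

end

section \<open>The interior of the isotropy of an etale groupoid\<close>

context etale_groupoid
begin

lemma rng_local_injective:
  assumes "a \<in> arrows G"
  obtains V where "openin (gtop G) V" "a \<in> V" "inj_on (rng G) V"
proof -
  obtain V where V: "openin (gtop G) V" "a \<in> V"
    "homeomorphic_map (subtopology (gtop G) V) (subtopology (unit_space G) (rng G ` V)) (rng G)"
    using local_homeo_rng assms by (auto simp: local_homeomorphism_def)
  moreover have "topspace (subtopology (gtop G) V) = V"
    using V(1) openin_subset by (metis topspace_subtopology_subset)
  ultimately show ?thesis
    using that homeomorphic_imp_injective_map by metis
qed

lemma open_map_rng_unit_space: "open_map (gtop G) (unit_space G) (rng G)"
  unfolding open_map_def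
proof (intro allI impI)
  fix U assume U: "openin (gtop G) U"
  show "openin (unit_space G) (rng G ` U)"
  proof (subst openin_subopen, intro ballI)
    fix y assume "y \<in> rng G ` U"
    then obtain a where a: "a \<in> U" "y = rng G a" by auto
    then have "a \<in> arrows G" using U openin_subset by blast
    then obtain V where V: "openin (gtop G) V" "a \<in> V" "openin (unit_space G) (rng G ` V)"
      "homeomorphic_map (subtopology (gtop G) V) (subtopology (unit_space G) (rng G ` V)) (rng G)"
      using local_homeo_rng by (auto simp: local_homeomorphism_def)
    have "openin (subtopology (gtop G) V) (U \<inter> V)"
      using U by (simp add: openin_subtopology_Int)
    then have "openin (subtopology (unit_space G) (rng G ` V)) (rng G ` (U \<inter> V))"
      using homeomorphic_imp_open_map[OF V(4)] by (simp add: open_map_def)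
    then have "openin (unit_space G) (rng G ` (U \<inter> V))"
      using V(3) openin_trans_full by blast
    then show "\<exists>T. openin (unit_space G) T \<and> y \<in> T \<and> T \<subseteq> rng G ` U"
      using a V(2) by blast
  qed
qed

text \<open>Near a unit, \<open>rng\<close> is injective and fixes the arrow it produces, so every arrow close to a unit
  equals its own range.\<close>

lemma open_units: "openin (gtop G) (units G)"
proof (subst openin_subopen, intro ballI)
  fix x assume x: "x \<in> units G"
  obtain V where V: "openin (gtop G) V" "x \<in> V" "inj_on (rng G) V"
    using rng_local_injective unitsD(1)[OF x] by metis
  let ?W = "{a \<in> arrows G. rng G a \<in> V} \<inter> V"
  have "openin (gtop G) ?W"
    using V(1) openin_continuous_map_preimage[OF continuous_rng] by blast
  moreover have "x \<in> ?W" using V(2) x unitsD by force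
  moreover have "?W \<subseteq> units G"
  proof
    fix a assume a: "a \<in> ?W"
    then have "rng G a = a"
      using V(3) rng_rng by (auto dest: inj_onD)
    then show "a \<in> units G" using rng_in_units a by force
  qed
  ultimately show "\<exists>T. openin (gtop G) T \<and> x \<in> T \<and> T \<subseteq> units G" by blast
qed

lemma open_map_rng: "open_map (gtop G) (gtop G) (rng G)"
  using open_map_rng_unit_space openin_open_subtopology[OF open_units]
  by (simp add: open_map_def unit_space_def)

text \<open>A compact set is covered by finitely many open sets on which \<open>rng\<close> is injective.\<close>

lemma finite_compact_fibre:
  assumes "compactin (gtop G) K"
  shows "finite {a \<in> K. rng G a = x}"
proof -
  let ?\<U> = "{V. openin (gtop G) V \<and> inj_on (rng G) V}"
  have "K \<subseteq> \<Union>?\<U>"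
  proof
    fix a assume "a \<in> K"
    then have "a \<in> arrows G" using compactin_subset_topspace[OF assms] by blast
    then show "a \<in> \<Union>?\<U>" by (rule rng_local_injective) blast
  qed
  then obtain \<F> where F: "finite \<F>" "\<F> \<subseteq> ?\<U>" "K \<subseteq> \<Union>\<F>"
    using compactinD[OF assms, of ?\<U>] by blast
  have "finite {a \<in> V. rng G a = x}" if "V \<in> \<F>" for V
  proof (rule finite_imageD)
    show "inj_on (rng G) {a \<in> V. rng G a = x}"
      using F(2) that by (auto intro: inj_on_subset)
    show "finite (rng G ` {a \<in> V. rng G a = x})"
      by (rule finite_subset[of _ "{x}"]) auto
  qed
  then have "finite (\<Union>V\<in>\<F>. {a \<in> V. rng G a = x})"
    using F(1) by blast
  then show ?thesis
    by (rule rev_finite_subset) (use F(3) in blast)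
qed

lemma isotropy_interior_open: "openin (gtop G) (arrows (isotropy_interior G))"
  and isotropy_interior_arrows: "a \<in> arrows (isotropy_interior G) \<Longrightarrow> a \<in> arrows G"
  and isotropy_interior_rng: "a \<in> arrows (isotropy_interior G) \<Longrightarrow> rng G a = src G a"
  using interior_of_subset[of "gtop G" "isotropy G"]
  by (auto simp: isotropy_interior_def restrict_groupoid_def isotropy_def openin_Int)

lemma units_in_isotropy_interior: "units G \<subseteq> arrows (isotropy_interior G)"
proof -
  have "units G \<subseteq> gtop G interior_of isotropy G"
    by (rule interior_of_maximal[OF _ open_units]) (use unitsD in \<open>force simp: isotropy_def\<close>)
  then show ?thesis
    using unitsD by (auto simp: isotropy_interior_def restrict_groupoid_def)
qed

text \<open>If \<open>g\<close> is a continuous local inverse of \<open>rng\<close> through \<open>a\<close>, with isotropy values, then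
  \<open>\<gamma> \<mapsto> g (rng \<gamma>) \<gamma>\<close> is continuous near \<open>a\<inverse> b\<close> and maps that arrow to \<open>b\<close>. Hence the arrows
  near \<open>a\<inverse> b\<close> become isotropy after multiplication by an isotropy arrow, so they are isotropy themselves.\<close>

lemma isotropy_interior_left_division:
  assumes a: "a \<in> arrows (isotropy_interior G)" and b: "b \<in> arrows (isotropy_interior G)"
    and ab: "rng G a = rng G b"
  shows "gmult G (ginv G a) b \<in> arrows (isotropy_interior G)"
proof -
  let ?I = "arrows (isotropy_interior G)"
  note I = isotropy_interior_arrows isotropy_interior_rng
  obtain V0 where V0: "openin (gtop G) V0" "a \<in> V0" "inj_on (rng G) V0"
    using rng_local_injective I(1)[OF a] by metis
  define V where "V = V0 \<inter> ?I"
  have V: "openin (gtop G) V" "a \<in> V" "inj_on (rng G) V" "V \<subseteq> ?I" "V \<subseteq> arrows G"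
    using V0 a isotropy_interior_open I by (auto simp: V_def intro: inj_on_subset)
  let ?Y = "subtopology (gtop G) (rng G ` V)"
  have topV: "topspace (subtopology (gtop G) V) = V"
    using V(5) by auto
  have rngV: "rng G ` V \<subseteq> arrows G" using V(5) rng_closed by auto
  have openr: "openin (gtop G) (rng G ` V)"
    using open_map_rng V(1) by (auto simp: open_map_def)
  have "homeomorphic_map (subtopology (gtop G) V) ?Y (rng G)"
  proof (rule bijective_open_imp_homeomorphic_map)
    show "continuous_map (subtopology (gtop G) V) ?Y (rng G)"
      using continuous_rng V(5) by (auto simp: continuous_map_in_subtopology continuous_map_from_subtopology)
    show "open_map (subtopology (gtop G) V) ?Y (rng G)"
      using open_map_rng V(1) openr unfolding open_map_def
      by (metis image_mono openin_imp_subset openin_open_subtopology)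
    show "rng G ` topspace (subtopology (gtop G) V) = topspace ?Y"
      using topV rngV by auto
    show "inj_on (rng G) (topspace (subtopology (gtop G) V))"
      using topV V(3) by simp
  qed
  then obtain g where g: "homeomorphic_maps (subtopology (gtop G) V) ?Y (rng G) g"
    by (auto simp: homeomorphic_map_maps)
  have gV: "g y \<in> V" "rng G (g y) = y" if "y \<in> rng G ` V" for y
  proof -
    have "y \<in> topspace ?Y" using that rngV by auto
    moreover have "continuous_map ?Y (subtopology (gtop G) V) g"
      using g by (simp add: homeomorphic_maps_def)
    ultimately show "g y \<in> V" "rng G (g y) = y"
      using g topV continuous_map_image_subset_topspace by (fastforce simp: homeomorphic_maps_def)+
  qed
  let ?W = "{c \<in> arrows G. rng G c \<in> rng G ` V}"
  have openW: "openin (gtop G) ?W"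
    using openin_continuous_map_preimage[OF continuous_rng openr] .
  let ?m = "\<lambda>c. gmult G (g (rng G c)) c"
  have contm: "continuous_map (subtopology (gtop G) ?W) (gtop G) ?m"
  proof (rule continuous_map_mult)
    have "continuous_map (subtopology (gtop G) ?W) ?Y (rng G)"
      using continuous_rng by (auto simp: continuous_map_in_subtopology continuous_map_from_subtopology)
    moreover have "continuous_map ?Y (gtop G) g"
      using g by (simp add: homeomorphic_maps_def continuous_map_in_subtopology)
    ultimately show "continuous_map (subtopology (gtop G) ?W) (gtop G) (\<lambda>c. g (rng G c))"
      using continuous_map_compose by (fastforce simp: o_def)
    show "continuous_map (subtopology (gtop G) ?W) (gtop G) (\<lambda>c. c)"
      using continuous_map_from_subtopology[OF continuous_map_id] by (simp add: id_def)
    show "src G (g (rng G c)) = rng G c" if "c \<in> topspace (subtopology (gtop G) ?W)" for c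
    proof -
      from that have "rng G c \<in> rng G ` V" by auto
      from gV[OF this] show ?thesis using I V(4) by auto
    qed
  qed
  let ?U = "{c \<in> topspace (subtopology (gtop G) ?W). ?m c \<in> ?I}"
  have "openin (subtopology (gtop G) ?W) ?U"
    by (rule openin_continuous_map_preimage[OF contm isotropy_interior_open])
  then have openU: "openin (gtop G) ?U"
    using openW openin_trans_full by blast
  have "?U \<subseteq> isotropy G"
  proof
    fix c assume c: "c \<in> ?U"
    then have cc: "c \<in> arrows G" "rng G c \<in> rng G ` V" "?m c \<in> ?I" by auto
    have comp: "(g (rng G c), c) \<in> composable G"
      using gV[OF cc(2)] cc(1) V I by (force simp: composable_def)
    have "rng G (?m c) = rng G c" using rng_mult[OF comp] gV[OF cc(2)] by simp
    moreover have "src G (?m c) = src G c" using src_mult[OF comp] .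
    ultimately show "c \<in> isotropy G"
      using I(2)[OF cc(3)] cc(1) by (simp add: isotropy_def)
  qed
  then have "?U \<subseteq> gtop G interior_of isotropy G"
    using openU by (rule interior_of_maximal)
  then have "?U \<subseteq> ?I" by (auto simp: isotropy_interior_def restrict_groupoid_def)
  moreover have "gmult G (ginv G a) b \<in> ?U"
  proof -
    let ?d = "gmult G (ginv G a) b"
    have d: "?d \<in> arrows G" "rng G ?d = rng G a"
      using left_division[of a b] I a b ab by auto
    have "g (rng G a) = a"
      using gV[of "rng G a"] V(2,3) by (auto dest: inj_onD)
    then have "?m ?d = b"
      using d mult_cancel_inv_left[of a b] I a b ab by simp
    then show ?thesis using d V(2) b by auto
  qed
  ultimately show ?thesis by blast
qed

text \<open>On the interior of the isotropy \<open>rng\<close> and \<open>src\<close> agree, and an injective restriction of the open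
  map \<open>rng\<close> is a homeomorphism onto its image.\<close>

lemma bisection_isotropy_interior:
  assumes S: "openin (gtop G) S" "S \<subseteq> arrows (isotropy_interior G)" and inj: "inj_on (rng G) S"
  shows "bisection (isotropy_interior G) S"
proof -
  let ?H = "isotropy_interior G"
  have unitsH: "units ?H = units G"
  proof -
    have "src G x = x" if "x \<in> units G" for x using unitsD that by auto
    then have "units G \<subseteq> src G ` arrows ?H"
      using units_in_isotropy_interior by (metis image_eqI subset_eq)
    moreover have "src G ` arrows ?H \<subseteq> units G"
      using isotropy_interior_arrows by (auto simp: units_def)
    moreover have "src ?H = src G"
      by (simp add: isotropy_interior_def restrict_groupoid_def)
    ultimately show ?thesis by (auto simp: units_def)
  qed
  have gt: "gtop ?H = subtopology (gtop G) (arrows ?H)"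
    by (auto simp: isotropy_interior_def restrict_groupoid_def subtopology_restrict)
  have us: "unit_space ?H = unit_space G"
    unfolding unit_space_def unitsH
    by (subst gt) (use units_in_isotropy_interior in \<open>simp add: subtopology_subtopology Int_absorb1\<close>)
  have st: "subtopology (gtop ?H) S = subtopology (gtop G) S"
    by (subst gt) (use S(2) in \<open>simp add: subtopology_subtopology Int_absorb1\<close>)
  have fn: "rng ?H = rng G" "src ?H = src G"
    by (simp_all add: isotropy_interior_def restrict_groupoid_def)
  have SG: "S \<subseteq> arrows G" using S(1) openin_subset by blast
  have rs: "rng G a = src G a" if "a \<in> S" for a
    using that S(2) isotropy_interior_rng by blast
  have im: "src G ` S = rng G ` S" using rs by force
  have openr: "openin (unit_space G) (rng G ` S)"
    using open_map_rng_unit_space S(1) by (simp add: open_map_def)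
  let ?Y = "subtopology (unit_space G) (rng G ` S)"
  have topY: "topspace ?Y = rng G ` S"
    using openr openin_subset by (metis topspace_subtopology_subset)
  have hom: "homeomorphic_map (subtopology (gtop G) S) ?Y (rng G)"
  proof (rule bijective_open_imp_homeomorphic_map)
    show "continuous_map (subtopology (gtop G) S) ?Y (rng G)"
      using continuous_rng SG rng_in_units
      by (auto simp: unit_space_def continuous_map_in_subtopology continuous_map_from_subtopology)
    show "open_map (subtopology (gtop G) S) ?Y (rng G)"
      using open_map_rng_unit_space S(1) openr unfolding open_map_def
      by (metis image_mono openin_imp_subset openin_open_subtopology)
    show "rng G ` topspace (subtopology (gtop G) S) = topspace ?Y"
      using SG topY by (simp add: Int_absorb1)
    show "inj_on (rng G) (topspace (subtopology (gtop G) S))"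
      using inj SG by (simp add: Int_absorb1)
  qed
  moreover have "homeomorphic_map (subtopology (gtop G) S) ?Y (src G)"
    by (rule homeomorphic_map_eq[OF hom]) (simp add: rs)
  moreover have "openin (gtop ?H) S"
    by (subst gt) (use S isotropy_interior_open openin_open_subtopology in blast)
  ultimately show ?thesis
    unfolding bisection_def us fn
    by (intro exI[of _ S]) (simp add: st im openr)
qed

end

section \<open>The fibres of a twist\<close>

lemma runits_iff: "t \<in> runits \<longleftrightarrow> (\<exists>u. t * u = 1)"
  by (simp add: runits_def dvd_def eq_commute[of 1])

lemma runitsI: "t * u = 1 \<Longrightarrow> t \<in> runits" "t * u = 1 \<Longrightarrow> u \<in> runits"
  by (auto simp: runits_iff) (metis mult.commute)

lemma one_in_runits: "1 \<in> runits"
  by (simp add: runits_def)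

lemma mult_in_runits: "t \<in> runits \<Longrightarrow> u \<in> runits \<Longrightarrow> t * u \<in> runits"
  using mult_dvd_mono[of t 1 u 1] by (simp add: runits_def)

context discrete_twist
begin

abbreviation act :: "'r \<Rightarrow> 's \<Rightarrow> 's" where
  "act \<equiv> twist_act \<Sigma> i q"

lemma i_fibre:
  assumes "x \<in> units G" "t \<in> runits"
  shows "i (x, t) \<in> arrows \<Sigma>" "q (i (x, t)) = x"
    "rng \<Sigma> (i (x, t)) = i (x, 1)" "src \<Sigma> (i (x, t)) = i (x, 1)"
proof -
  have "i (x, t) \<in> i ` ({x} \<times> runits)" using assms by blast
  then show "i (x, t) \<in> arrows \<Sigma>" "q (i (x, t)) = x"
    using exact[OF assms(1)] by auto
  have "(x, t) \<in> arrows (trivial_bundle G)"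
    using assms G.unitsD by (auto simp: trivial_bundle_def unit_space_def)
  then show "rng \<Sigma> (i (x, t)) = i (x, 1)" "src \<Sigma> (i (x, t)) = i (x, 1)"
    using hom_i unfolding groupoid_hom_def by (auto simp: trivial_bundle_def)
qed

lemma fibre_over_unit:
  assumes "\<sigma> \<in> arrows \<Sigma>" "q \<sigma> \<in> units G"
  obtains t where "t \<in> runits" "\<sigma> = i (q \<sigma>, t)"
  using exact[OF assms(2)] assms(1) by blast

lemma i_mult:
  assumes "x \<in> units G" "t \<in> runits" "u \<in> runits"
  shows "gmult \<Sigma> (i (x, t)) (i (x, u)) = i (x, t * u)"
proof -
  have "((x, t), (x, u)) \<in> composable (trivial_bundle G)"
    using assms G.unitsD by (auto simp: trivial_bundle_def unit_space_def composable_def)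
  then have "i (gmult (trivial_bundle G) (x, t) (x, u)) = gmult \<Sigma> (i (x, t)) (i (x, u))"
    using hom_i unfolding groupoid_hom_def by blast
  then show ?thesis by (simp add: trivial_bundle_def)
qed

lemma q_arrow:
  assumes "\<sigma> \<in> arrows \<Sigma>"
  shows "q \<sigma> \<in> arrows G" "q (rng \<Sigma> \<sigma>) = rng G (q \<sigma>)" "q (src \<Sigma> \<sigma>) = src G (q \<sigma>)"
  using hom_q assms by (auto simp: groupoid_hom_def)

lemma q_mult:
  assumes "(\<sigma>, \<tau>) \<in> composable \<Sigma>"
  shows "q (gmult \<Sigma> \<sigma> \<tau>) = gmult G (q \<sigma>) (q \<tau>)"
  using hom_q assms unfolding groupoid_hom_def by fast

lemma rng_src_eq:
  assumes "\<sigma> \<in> arrows \<Sigma>"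
  shows "rng \<Sigma> \<sigma> = i (rng G (q \<sigma>), 1)" "src \<Sigma> \<sigma> = i (src G (q \<sigma>), 1)"
proof -
  have "\<upsilon> = i (q \<upsilon>, 1)" if "\<upsilon> \<in> units \<Sigma>" for \<upsilon>
    using that units_i by (auto simp: i_fibre(2) one_in_runits)
  then show "rng \<Sigma> \<sigma> = i (rng G (q \<sigma>), 1)" "src \<Sigma> \<sigma> = i (src G (q \<sigma>), 1)"
    using \<Sigma>.rng_in_units \<Sigma>.src_in_units q_arrow assms by metis+
qed

lemma act_eq: "\<sigma> \<in> arrows \<Sigma> \<Longrightarrow> act t \<sigma> = gmult \<Sigma> (i (rng G (q \<sigma>), t)) \<sigma>"
  by (simp add: twist_act_def q_arrow)

lemma act_composable:
  assumes "\<sigma> \<in> arrows \<Sigma>" "t \<in> runits"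
  shows "(i (rng G (q \<sigma>), t), \<sigma>) \<in> composable \<Sigma>"
  using assms i_fibre G.rng_in_units q_arrow rng_src_eq by (simp add: composable_def)

lemma act_arrow:
  assumes "\<sigma> \<in> arrows \<Sigma>" "t \<in> runits"
  shows "act t \<sigma> \<in> arrows \<Sigma>" "q (act t \<sigma>) = q \<sigma>"
  using assms act_composable[OF assms] act_eq i_fibre G.rng_in_units q_arrow G.rng_mult_left
  by (simp_all add: \<Sigma>.mult_closed q_mult)

lemma act_i:
  assumes "x \<in> units G" "t \<in> runits" "u \<in> runits"
  shows "act t (i (x, u)) = i (x, t * u)"
  using assms act_eq i_fibre G.unitsD by (simp add: i_mult)

text \<open>The quotient \<open>\<tau> \<sigma>\<inverse>\<close> of two arrows over the same \<open>\<alpha>\<close> lies over the unit \<open>rng \<alpha>\<close>, and by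
  exactness the arrows over a unit are the scalars.\<close>

lemma fibre_transitive:
  assumes \<sigma>: "\<sigma> \<in> arrows \<Sigma>" and \<tau>: "\<tau> \<in> arrows \<Sigma>" and eq: "q \<sigma> = q \<tau>"
  obtains t where "t \<in> runits" "\<tau> = act t \<sigma>"
proof -
  let ?\<rho> = "gmult \<Sigma> \<tau> (ginv \<Sigma> \<sigma>)"
  have inv: "ginv \<Sigma> \<sigma> \<in> arrows \<Sigma>" using \<sigma> \<Sigma>.inv_closed by blast
  have src: "src \<Sigma> \<tau> = src \<Sigma> \<sigma>" using rng_src_eq \<sigma> \<tau> eq by metis
  have comp: "(\<tau>, ginv \<Sigma> \<sigma>) \<in> composable \<Sigma>" "(\<sigma>, ginv \<Sigma> \<sigma>) \<in> composable \<Sigma>"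
    "(ginv \<Sigma> \<sigma>, \<sigma>) \<in> composable \<Sigma>"
    using \<sigma> \<tau> inv src by (auto simp: composable_def \<Sigma>.rng_inv \<Sigma>.src_inv)
  have "q ?\<rho> = gmult G (q \<sigma>) (q (ginv \<Sigma> \<sigma>))" using q_mult comp(1) eq by simp
  also have "\<dots> = q (gmult \<Sigma> \<sigma> (ginv \<Sigma> \<sigma>))" using q_mult comp(2) by simp
  also have "\<dots> = rng G (q \<sigma>)" using \<sigma> by (simp add: \<Sigma>.mult_inv_right q_arrow)
  finally have "q ?\<rho> = rng G (q \<sigma>)" .
  moreover have "?\<rho> \<in> arrows \<Sigma>" using comp(1) by (rule \<Sigma>.mult_closed)
  moreover have "rng G (q \<sigma>) \<in> units G" using \<sigma> q_arrow G.rng_in_units by blast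
  ultimately obtain t where t: "t \<in> runits" "?\<rho> = i (rng G (q \<sigma>), t)"
    using fibre_over_unit by metis
  have "act t \<sigma> = gmult \<Sigma> ?\<rho> \<sigma>" using t \<sigma> by (simp add: act_eq)
  also have "\<dots> = gmult \<Sigma> \<tau> (gmult \<Sigma> (ginv \<Sigma> \<sigma>) \<sigma>)"
    using comp by (intro \<Sigma>.mult_assoc)
  also have "\<dots> = \<tau>" using \<sigma> \<tau> src by (metis \<Sigma>.mult_inv_left \<Sigma>.src_mult_right)
  finally show ?thesis using that t(1) by metis
qed

lemma rng_eq_iff:
  assumes "\<sigma> \<in> arrows \<Sigma>" "\<tau> \<in> arrows \<Sigma>"
  shows "rng \<Sigma> \<sigma> = rng \<Sigma> \<tau> \<longleftrightarrow> rng G (q \<sigma>) = rng G (q \<tau>)"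
  using assms rng_src_eq q_arrow by metis

lemma q_left_division:
  assumes "\<tau> \<in> arrows \<Sigma>" "\<sigma> \<in> arrows \<Sigma>" "rng G (q \<tau>) = rng G (q \<sigma>)"
  shows "q (gmult \<Sigma> (ginv \<Sigma> \<tau>) \<sigma>) = gmult G (ginv G (q \<tau>)) (q \<sigma>)"
proof -
  let ?\<rho> = "gmult \<Sigma> (ginv \<Sigma> \<tau>) \<sigma>"
  have r: "rng \<Sigma> \<tau> = rng \<Sigma> \<sigma>" using assms rng_eq_iff by blast
  note \<rho> = \<Sigma>.left_division[OF assms(1,2) r]
  have comp: "(\<tau>, ?\<rho>) \<in> composable \<Sigma>" using \<rho> assms by (simp add: composable_def)
  have "gmult G (q \<tau>) (q ?\<rho>) = q \<sigma>"
    using q_mult[OF comp] \<Sigma>.mult_cancel_inv_left[OF assms(1,2) r] by simp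
  moreover have "gmult G (ginv G (q \<tau>)) (gmult G (q \<tau>) (q ?\<rho>)) = q ?\<rho>"
    using \<rho> assms q_arrow by (intro G.mult_inv_cancel_left) metis+
  ultimately show ?thesis by simp
qed

text \<open>Centrality moves the scalar \<open>u\<close> past \<open>\<tau>\<close>, which gives \<open>(t \<cdot> \<tau>) (u \<cdot> \<tau>\<inverse> \<sigma>) = (t u) \<cdot> \<sigma> = \<sigma>\<close>; then
  \<open>t \<cdot> \<tau>\<close> is cancelled.\<close>

lemma act_left_division:
  assumes \<tau>: "\<tau> \<in> arrows \<Sigma>" and \<sigma>: "\<sigma> \<in> arrows \<Sigma>" and r: "rng G (q \<tau>) = rng G (q \<sigma>)"
    and tu: "t * u = 1"
  shows "gmult \<Sigma> (ginv \<Sigma> (act t \<tau>)) \<sigma> = act u (gmult \<Sigma> (ginv \<Sigma> \<tau>) \<sigma>)"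
proof -
  have T: "t \<in> runits" and U: "u \<in> runits" using tu runitsI by blast+
  let ?\<rho> = "gmult \<Sigma> (ginv \<Sigma> \<tau>) \<sigma>" and ?x = "rng G (q \<tau>)" and ?y = "src G (q \<tau>)"
  have x: "?x \<in> units G" and y: "?y \<in> units G"
    using \<tau> q_arrow G.rng_in_units G.src_in_units by blast+
  have r': "rng \<Sigma> \<tau> = rng \<Sigma> \<sigma>" using \<tau> \<sigma> r rng_eq_iff by blast
  note \<rho> = \<Sigma>.left_division[OF \<tau> \<sigma> r']
  have q\<rho>: "rng G (q ?\<rho>) = ?y" using \<rho> \<tau> q_arrow by metis
  note ix = i_fibre[OF x T] i_fibre[OF x U] and iy = i_fibre[OF y U]
  have ends: "rng \<Sigma> \<tau> = i (?x, 1)" "src \<Sigma> \<tau> = i (?y, 1)" "rng \<Sigma> ?\<rho> = i (?y, 1)"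
    "rng \<Sigma> \<sigma> = i (?x, 1)"
    using rng_src_eq \<tau> \<rho> r' by auto
  have act\<rho>: "act u ?\<rho> = gmult \<Sigma> (i (?y, u)) ?\<rho>" using \<rho>(1) q\<rho> by (simp add: act_eq)
  have act\<tau>: "act t \<tau> = gmult \<Sigma> (i (?x, t)) \<tau>" using \<tau> by (simp add: act_eq)
  have c1: "(i (?x, t), \<tau>) \<in> composable \<Sigma>" "(i (?x, u), \<tau>) \<in> composable \<Sigma>"
    "(i (?y, u), ?\<rho>) \<in> composable \<Sigma>" "(\<tau>, i (?y, u)) \<in> composable \<Sigma>" "(\<tau>, ?\<rho>) \<in> composable \<Sigma>"
    "(i (?x, t), i (?x, u)) \<in> composable \<Sigma>" "(i (?x, u), \<sigma>) \<in> composable \<Sigma>"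
    using ix iy ends \<tau> \<sigma> \<rho> by (auto simp: composable_def)
  have c2: "(\<tau>, act u ?\<rho>) \<in> composable \<Sigma>"
    using c1(3) iy ends \<tau> by (simp add: composable_def act\<rho> \<Sigma>.mult_closed \<Sigma>.rng_mult)
  have "gmult \<Sigma> \<tau> (act u ?\<rho>) = gmult \<Sigma> (gmult \<Sigma> \<tau> (i (?y, u))) ?\<rho>"
    unfolding act\<rho> using \<Sigma>.mult_assoc c1 by metis
  also have "gmult \<Sigma> \<tau> (i (?y, u)) = gmult \<Sigma> (i (?x, u)) \<tau>"
    using central[OF \<tau> U] q_arrow[OF \<tau>] by simp
  also have "gmult \<Sigma> (gmult \<Sigma> (i (?x, u)) \<tau>) ?\<rho> = gmult \<Sigma> (i (?x, u)) \<sigma>"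
    using \<Sigma>.mult_assoc c1 \<Sigma>.mult_cancel_inv_left[OF \<tau> \<sigma> r'] by metis
  finally have "gmult \<Sigma> (act t \<tau>) (act u ?\<rho>) = gmult \<Sigma> (i (?x, t)) (gmult \<Sigma> (i (?x, u)) \<sigma>)"
    unfolding act\<tau> using \<Sigma>.mult_assoc[OF c1(1) c2] by simp
  also have "\<dots> = gmult \<Sigma> (i (?x, t * u)) \<sigma>"
    using \<Sigma>.mult_assoc[OF c1(6,7)] i_mult[OF x T U] by simp
  also have "\<dots> = \<sigma>" using tu ends(4) \<Sigma>.rng_mult_left[OF \<sigma>] by simp
  finally have eq: "gmult \<Sigma> (act t \<tau>) (act u ?\<rho>) = \<sigma>" .
  have "gmult \<Sigma> (ginv \<Sigma> (act t \<tau>)) (gmult \<Sigma> (act t \<tau>) (act u ?\<rho>)) = act u ?\<rho>"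
  proof (rule \<Sigma>.mult_inv_cancel_left)
    show "act t \<tau> \<in> arrows \<Sigma>" "act u ?\<rho> \<in> arrows \<Sigma>"
      using act_arrow(1) \<tau> \<rho>(1) T U by blast+
    show "src \<Sigma> (act t \<tau>) = rng \<Sigma> (act u ?\<rho>)"
      using c2 \<Sigma>.src_mult[OF c1(1)] by (simp add: act\<tau> composable_def)
  qed
  then show ?thesis using eq by simp
qed

lemma act_one: "\<sigma> \<in> arrows \<Sigma> \<Longrightarrow> act 1 \<sigma> = \<sigma>"
  using act_eq rng_src_eq \<Sigma>.rng_mult_left by metis

lemma act_mult:
  assumes "(\<sigma>, \<tau>) \<in> composable \<Sigma>" "t \<in> runits"
  shows "gmult \<Sigma> (act t \<sigma>) \<tau> = act t (gmult \<Sigma> \<sigma> \<tau>)"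
proof -
  have \<sigma>: "\<sigma> \<in> arrows \<Sigma>" using assms by (simp add: composable_def)
  have "rng G (q (gmult \<Sigma> \<sigma> \<tau>)) = rng G (q \<sigma>)"
    using assms \<Sigma>.mult_closed \<Sigma>.rng_mult rng_eq_iff \<sigma> by blast
  then show ?thesis
    using \<Sigma>.mult_assoc[OF act_composable[OF \<sigma> assms(2)] assms(1)] \<sigma> \<Sigma>.mult_closed[OF assms(1)]
    by (simp add: act_eq)
qed

lemma act_act:
  assumes "\<sigma> \<in> arrows \<Sigma>" "t \<in> runits" "u \<in> runits"
  shows "act t (act u \<sigma>) = act (t * u) \<sigma>"
proof -
  let ?x = "rng G (q \<sigma>)"
  have x: "?x \<in> units G" using assms q_arrow G.rng_in_units by blast
  have "act t (act u \<sigma>) = gmult \<Sigma> (act t (i (?x, u))) \<sigma>"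
    using act_mult[OF act_composable[OF assms(1,3)] assms(2)] assms(1) by (simp add: act_eq)
  also have "\<dots> = act (t * u) \<sigma>"
    using assms x by (simp add: act_i act_eq)
  finally show ?thesis .
qed

section \<open>The topology of a twist\<close>

lemma trivialisation_at:
  assumes "\<alpha> \<in> arrows G"
  obtains D P h where "openin (gtop G) D" "\<alpha> \<in> D"
    "\<And>\<beta>. \<beta> \<in> D \<Longrightarrow> P \<beta> \<in> arrows \<Sigma> \<and> q (P \<beta>) = \<beta>"
    "\<And>\<beta> t. \<beta> \<in> D \<Longrightarrow> h (\<beta>, t) = act t (P \<beta>)"
    "homeomorphic_map (prod_topology (subtopology (gtop G) D) (discrete_topology runits))
       (subtopology (gtop \<Sigma>) {\<sigma> \<in> arrows \<Sigma>. q \<sigma> \<in> D}) h"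
    "openin (gtop \<Sigma>) {\<sigma> \<in> arrows \<Sigma>. q \<sigma> \<in> D}"
proof -
  obtain D P where D: "openin (gtop G) D" "\<alpha> \<in> D" and P: "continuous_map (subtopology (gtop G) D) (gtop \<Sigma>) P"
    "\<forall>\<beta>\<in>D. q (P \<beta>) = \<beta>"
    and h: "homeomorphic_map (prod_topology (subtopology (gtop G) D) (discrete_topology runits))
       (subtopology (gtop \<Sigma>) {\<sigma> \<in> arrows \<Sigma>. q \<sigma> \<in> D}) (\<lambda>(\<beta>, t). gmult \<Sigma> (i (rng G \<beta>, t)) (P \<beta>))"
    using local_trivialisation[OF assms] by blast
  have PS: "P \<beta> \<in> arrows \<Sigma> \<and> q (P \<beta>) = \<beta>" if "\<beta> \<in> D" for \<beta>
    using that P D(1) continuous_map_image_subset_topspace[OF P(1)] openin_subset by fastforce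
  show ?thesis
  proof (rule that[OF D PS _ h])
    show "(case (\<beta>, t) of (\<beta>, t) \<Rightarrow> gmult \<Sigma> (i (rng G \<beta>, t)) (P \<beta>)) = act t (P \<beta>)" if "\<beta> \<in> D" for \<beta> t
      using PS[OF that] by (simp add: act_eq)
    show "openin (gtop \<Sigma>) {\<sigma> \<in> arrows \<Sigma>. q \<sigma> \<in> D}"
      using continuous_q D(1) by (rule openin_continuous_map_preimage)
  qed auto
qed

text \<open>In a local trivialisation an arrow \<open>\<sigma> = t \<cdot> P (q \<sigma>)\<close> lies on the continuous sheet \<open>\<beta> \<mapsto> t \<cdot> P \<beta>\<close>, which stays
  in a given neighbourhood of \<open>\<sigma>\<close> as long as \<open>\<beta>\<close> is close to \<open>q \<sigma>\<close>.\<close>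

lemma open_map_q: "open_map (gtop \<Sigma>) (gtop G) q"
  unfolding open_map_def
proof (intro allI impI)
  fix W assume W: "openin (gtop \<Sigma>) W"
  show "openin (gtop G) (q ` W)"
  proof (subst openin_subopen, intro ballI)
    fix \<alpha> assume "\<alpha> \<in> q ` W"
    then obtain \<sigma> where \<sigma>: "\<sigma> \<in> W" "\<alpha> = q \<sigma>" by blast
    have \<sigma>a: "\<sigma> \<in> arrows \<Sigma>" using W \<sigma> openin_subset by blast
    obtain D P h where D: "openin (gtop G) D" "q \<sigma> \<in> D"
      and P: "\<And>\<beta>. \<beta> \<in> D \<Longrightarrow> P \<beta> \<in> arrows \<Sigma> \<and> q (P \<beta>) = \<beta>"
      and h: "\<And>\<beta> t. \<beta> \<in> D \<Longrightarrow> h (\<beta>, t) = act t (P \<beta>)"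
      and hom: "homeomorphic_map (prod_topology (subtopology (gtop G) D) (discrete_topology runits))
        (subtopology (gtop \<Sigma>) {\<sigma> \<in> arrows \<Sigma>. q \<sigma> \<in> D}) h"
      and qD: "openin (gtop \<Sigma>) {\<sigma> \<in> arrows \<Sigma>. q \<sigma> \<in> D}"
      by (rule trivialisation_at[OF q_arrow(1)[OF \<sigma>a]]) (rule that)
    obtain t where t: "t \<in> runits" "\<sigma> = act t (P (q \<sigma>))"
      using fibre_transitive[of "P (q \<sigma>)" \<sigma>] P[OF D(2)] \<sigma>a by metis
    have "continuous_map (subtopology (gtop G) D)
        (prod_topology (subtopology (gtop G) D) (discrete_topology runits)) (\<lambda>\<beta>. (\<beta>, t))"
      using t(1) by (intro continuous_map_pairedI) auto
    moreover have "continuous_map (prod_topology (subtopology (gtop G) D) (discrete_topology runits)) (gtop \<Sigma>) h"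
      using homeomorphic_imp_continuous_map[OF hom] by (simp add: continuous_map_in_subtopology)
    ultimately have cont: "continuous_map (subtopology (gtop G) D) (gtop \<Sigma>) (\<lambda>\<beta>. h (\<beta>, t))"
      using continuous_map_compose by (fastforce simp: o_def)
    let ?U = "{\<beta> \<in> topspace (subtopology (gtop G) D). h (\<beta>, t) \<in> W}"
    have "openin (gtop G) ?U"
      using openin_continuous_map_preimage[OF cont W] D(1) openin_trans_full by blast
    moreover have "\<alpha> \<in> ?U" using \<sigma> t D h q_arrow \<sigma>a by simp
    moreover have "?U \<subseteq> q ` W"
    proof
      fix \<beta> assume \<beta>: "\<beta> \<in> ?U"
      then have "q (h (\<beta>, t)) = \<beta>" using h P act_arrow t(1) by auto
      then show "\<beta> \<in> q ` W" using \<beta> by force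
    qed
    ultimately show "\<exists>T. openin (gtop G) T \<and> \<alpha> \<in> T \<and> T \<subseteq> q ` W" by blast
  qed
qed

text \<open>In a local trivialisation around \<open>x\<close>, the open sheet of \<open>P\<close> and the continuous sheet
  \<open>\<beta> \<mapsto> i (\<beta>, p)\<close> through the same point \<open>P x = i (x, p)\<close> agree near \<open>x\<close>. Thus the trivialisation
  identifies the sheets of \<open>i\<close> with products of an open set and a point.\<close>

lemma open_sheet:
  assumes U: "openin (gtop G) U" "U \<subseteq> units G" and t: "t \<in> runits"
  shows "openin (gtop \<Sigma>) (i ` (U \<times> {t}))"
proof (subst openin_subopen, intro ballI)
  fix \<sigma> assume "\<sigma> \<in> i ` (U \<times> {t})"
  then obtain x where x: "x \<in> U" "\<sigma> = i (x, t)" by blast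
  have xu: "x \<in> units G" using x U by blast
  obtain D P h where D: "openin (gtop G) D" "x \<in> D"
      and P: "\<And>\<beta>. \<beta> \<in> D \<Longrightarrow> P \<beta> \<in> arrows \<Sigma> \<and> q (P \<beta>) = \<beta>"
      and h: "\<And>\<beta> t. \<beta> \<in> D \<Longrightarrow> h (\<beta>, t) = act t (P \<beta>)"
      and hom: "homeomorphic_map (prod_topology (subtopology (gtop G) D) (discrete_topology runits))
        (subtopology (gtop \<Sigma>) {\<sigma> \<in> arrows \<Sigma>. q \<sigma> \<in> D}) h"
      and qD: "openin (gtop \<Sigma>) {\<sigma> \<in> arrows \<Sigma>. q \<sigma> \<in> D}"
      by (rule trivialisation_at[OF G.unitsD(1)[OF xu]]) (rule that)
  have open_h: "openin (gtop \<Sigma>) (h ` (V \<times> {u}))"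
    if V: "openin (gtop G) V" "V \<subseteq> D" and u: "u \<in> runits" for V u
  proof -
    have "openin (subtopology (gtop G) D) V"
      using V D(1) openin_open_subtopology by blast
    then have "openin (prod_topology (subtopology (gtop G) D) (discrete_topology runits)) (V \<times> {u})"
      using u by (simp add: openin_prod_Times_iff)
    then show ?thesis
      using homeomorphic_imp_open_map[OF hom] qD openin_trans_full unfolding open_map_def by blast
  qed
  obtain p where p: "p \<in> runits" "P x = i (x, p)"
    using fibre_over_unit[of "P x"] P[OF D(2)] xu by metis
  obtain p' where p': "p * p' = 1" using p by (auto simp: runits_iff)
  have tp: "t * p' \<in> runits" using t p' runitsI mult_in_runits by blast
  have "continuous_map (unit_space G) (gtop (trivial_bundle G)) (\<lambda>\<beta>. (\<beta>, p))"
    using p(1) by (simp add: trivial_bundle_def continuous_map_pairedI)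
  then have cont: "continuous_map (unit_space G) (gtop \<Sigma>) (\<lambda>\<beta>. i (\<beta>, p))"
    using continuous_map_compose[OF _ continuous_i] by (fastforce simp: o_def)
  \<comment> \<open>\<open>?W\<close> is the image of \<open>P\<close>; on \<open>?V\<close> the arrow \<open>i (\<beta>, p)\<close> lies in it, so it can only be \<open>P \<beta>\<close>.\<close>
  let ?W = "h ` (D \<times> {1})"
  let ?V = "{\<beta> \<in> topspace (unit_space G). i (\<beta>, p) \<in> ?W} \<inter> U \<inter> D"
  have "openin (unit_space G) {\<beta> \<in> topspace (unit_space G). i (\<beta>, p) \<in> ?W}"
    using openin_continuous_map_preimage[OF cont open_h[OF D(1) _ one_in_runits]] by blast
  then have "openin (gtop G) {\<beta> \<in> topspace (unit_space G). i (\<beta>, p) \<in> ?W}"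
    using openin_trans_full[OF _ G.open_units] by (simp add: unit_space_def)
  then have openV: "openin (gtop G) ?V" using U D by blast
  have h1: "h (\<beta>, 1) = P \<beta>" if "\<beta> \<in> D" for \<beta>
    using h[OF that] P[OF that] act_eq rng_src_eq \<Sigma>.rng_mult_left by metis
  have PV: "P \<beta> = i (\<beta>, p)" if "\<beta> \<in> ?V" for \<beta>
  proof -
    from that obtain \<gamma> where "\<gamma> \<in> D" "i (\<beta>, p) = h (\<gamma>, 1)" by auto
    then have g: "\<gamma> \<in> D" "i (\<beta>, p) = P \<gamma>" using h1 by auto
    have "\<beta> \<in> units G" using that U by blast
    then have "\<gamma> = \<beta>" using g P i_fibre p(1) by metis
    then show ?thesis using g by simp
  qed
  have hV: "h (\<beta>, t * p') = i (\<beta>, t)" if "\<beta> \<in> ?V" for \<beta>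
  proof -
    have "h (\<beta>, t * p') = act (t * p') (i (\<beta>, p))" using that h PV by auto
    also have "\<dots> = i (\<beta>, t * p' * p)" using that U act_i tp p by blast
    also have "t * p' * p = t * (p * p')" by (simp add: ac_simps)
    also have "\<dots> = t" using p' by simp
    finally show ?thesis .
  qed
  have "h ` (?V \<times> {t * p'}) = i ` (?V \<times> {t})"
  proof -
    have "h ` (?V \<times> {t * p'}) = (\<lambda>\<beta>. h (\<beta>, t * p')) ` ?V" by auto
    also have "\<dots> = (\<lambda>\<beta>. i (\<beta>, t)) ` ?V" using hV by (rule image_cong[OF refl])
    finally show ?thesis by auto
  qed
  moreover have "openin (gtop \<Sigma>) (h ` (?V \<times> {t * p'}))"
    using open_h[OF openV _ tp] by blast
  moreover have "x \<in> ?V"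
    using x D p h1 xu G.unitsD by (auto simp: unit_space_def intro!: image_eqI[of _ h "(x, 1)"])
  ultimately show "\<exists>T. openin (gtop \<Sigma>) T \<and> \<sigma> \<in> T \<and> T \<subseteq> i ` (U \<times> {t})"
    using x(2) by (intro exI[of _ "i ` (?V \<times> {t})"]) auto
qed

section \<open>The twisted Steinberg algebra of the isotropy\<close>

abbreviation \<I> :: "'g set" where "\<I> \<equiv> arrows (isotropy_interior G)"

abbreviation \<J> :: "'s set" where "\<J> \<equiv> arrows (isotropy_twist G \<Sigma> q)"

abbreviation \<A> :: "('s \<Rightarrow> 'r) set" where
  "\<A> \<equiv> steinberg_algebra (isotropy_interior G) (isotropy_twist G \<Sigma> q) i q"

abbreviation \<B> :: "('s \<Rightarrow> 'r) set" where
  "\<B> \<equiv> diagonal_subalgebra (isotropy_interior G) (isotropy_twist G \<Sigma> q) i q"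

abbreviation convolution :: "('s \<Rightarrow> 'r) \<Rightarrow> ('s \<Rightarrow> 'r) \<Rightarrow> 's \<Rightarrow> 'r"  (infixl \<open>\<star>\<close> 70) where
  "f \<star> g \<equiv> steinberg_mult (isotropy_interior G) (isotropy_twist G \<Sigma> q) q f g"

lemma \<J>_iff: "\<sigma> \<in> \<J> \<longleftrightarrow> \<sigma> \<in> arrows \<Sigma> \<and> q \<sigma> \<in> \<I>"
  by (auto simp: isotropy_twist_def restrict_groupoid_def)

lemma \<J>_open: "openin (gtop \<Sigma>) \<J>"
  using openin_continuous_map_preimage[OF continuous_q G.isotropy_interior_open] \<J>_iff
  by (metis (no_types, lifting) Collect_cong Collect_mem_eq)

lemma compactin_isotropy:
  "compactin (gtop (isotropy_interior G)) K \<longleftrightarrow> compactin (gtop G) K \<and> K \<subseteq> \<I>"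
  by (auto simp: isotropy_interior_def restrict_groupoid_def compactin_subtopology
      dest: compactin_subset_topspace)

lemma openin_isotropy_twist:
  "openin (gtop (isotropy_twist G \<Sigma> q)) V \<longleftrightarrow> openin (gtop \<Sigma>) V \<and> V \<subseteq> \<J>"
proof -
  have "gtop (isotropy_twist G \<Sigma> q) = subtopology (gtop \<Sigma>) \<J>"
    by (simp add: isotropy_twist_def restrict_groupoid_def subtopology_restrict)
  then show ?thesis
    using openin_open_subtopology[OF \<J>_open] by metis
qed

lemma isotropy_operations [simp]:
  "rng (isotropy_interior G) = rng G" "src (isotropy_interior G) = src G"
  "gmult (isotropy_interior G) = gmult G"
  "rng (isotropy_twist G \<Sigma> q) = rng \<Sigma>" "src (isotropy_twist G \<Sigma> q) = src \<Sigma>"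
  "gmult (isotropy_twist G \<Sigma> q) = gmult \<Sigma>" "ginv (isotropy_twist G \<Sigma> q) = ginv \<Sigma>"
  "twist_act (isotropy_twist G \<Sigma> q) i q = act"
  by (auto simp: isotropy_interior_def isotropy_twist_def restrict_groupoid_def twist_act_def fun_eq_iff)

lemma units_isotropy_interior: "units (isotropy_interior G) = units G"
proof
  show "units (isotropy_interior G) \<subseteq> units G"
    using G.isotropy_interior_arrows by (auto simp: units_def)
  show "units G \<subseteq> units (isotropy_interior G)"
  proof
    fix x assume "x \<in> units G"
    then show "x \<in> units (isotropy_interior G)"
      using G.units_in_isotropy_interior G.unitsD(2)[of x] by (auto simp: units_def[of "isotropy_interior G"] intro!: image_eqI[of _ _ x])
  qed
qed

lemma \<J>_left_division:
  assumes "\<tau> \<in> \<J>" "\<sigma> \<in> \<J>" "rng G (q \<tau>) = rng G (q \<sigma>)"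
  shows "gmult \<Sigma> (ginv \<Sigma> \<tau>) \<sigma> \<in> \<J>"
  using assms q_left_division G.isotropy_interior_left_division rng_eq_iff \<Sigma>.left_division(1)
  by (simp add: \<J>_iff)

lemma steinbergD:
  assumes "f \<in> \<A>"
  shows "f \<sigma> \<noteq> 0 \<Longrightarrow> \<sigma> \<in> \<J>"
    and "\<sigma> \<in> \<J> \<Longrightarrow> t * u = 1 \<Longrightarrow> f (act t \<sigma>) = u * f \<sigma>"
    and "compactin (gtop G) (q ` supp f)"
    and "q ` supp f \<subseteq> \<I>"
proof -
  have "supp f \<subseteq> \<J>" and act: "\<forall>\<sigma>\<in>\<J>. \<forall>t u. t * u = 1 \<longrightarrow> f (act t \<sigma>) = u * f \<sigma>"
    and "compactin (gtop (isotropy_interior G)) (q ` supp f)"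
    using assms by (simp_all add: steinberg_algebra_def)
  then show "f \<sigma> \<noteq> 0 \<Longrightarrow> \<sigma> \<in> \<J>" "compactin (gtop G) (q ` supp f)" "q ` supp f \<subseteq> \<I>"
    by (auto simp: supp_def compactin_isotropy)
  show "\<sigma> \<in> \<J> \<Longrightarrow> t * u = 1 \<Longrightarrow> f (act t \<sigma>) = u * f \<sigma>"
    using act by blast
qed

lemma open_support:
  assumes "f \<in> \<A>"
  shows "openin (gtop G) (q ` supp f)"
proof -
  have "openin (gtop (isotropy_twist G \<Sigma> q)) (supp f)"
  proof (subst openin_subopen, intro ballI)
    fix \<sigma> assume \<sigma>: "\<sigma> \<in> supp f"
    then have "\<sigma> \<in> \<J>" using steinbergD(1)[OF assms] by (simp add: supp_def)
    have "\<forall>\<sigma>\<in>\<J>. \<exists>V. openin (gtop (isotropy_twist G \<Sigma> q)) V \<and> \<sigma> \<in> V \<and> (\<forall>\<tau>\<in>V. f \<tau> = f \<sigma>)"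
      using assms by (simp add: steinberg_algebra_def)
    from bspec[OF this \<open>\<sigma> \<in> \<J>\<close>]
    obtain V where V: "openin (gtop (isotropy_twist G \<Sigma> q)) V" "\<sigma> \<in> V" "\<forall>\<tau>\<in>V. f \<tau> = f \<sigma>"
      by (elim exE conjE)
    have "V \<subseteq> supp f"
    proof
      fix \<tau> assume "\<tau> \<in> V"
      then have "f \<tau> = f \<sigma>" using V(3) by (rule bspec[rotated])
      then show "\<tau> \<in> supp f" using \<sigma> by (simp add: supp_def)
    qed
    then show "\<exists>T. openin (gtop (isotropy_twist G \<Sigma> q)) T \<and> \<sigma> \<in> T \<and> T \<subseteq> supp f"
      using V(1,2) by blast
  qed
  then have "openin (gtop \<Sigma>) (supp f)"
    by (simp add: openin_isotropy_twist)
  then show ?thesis using open_map_q by (simp add: open_map_def)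
qed

lemma \<J>_fibre_transitive:
  assumes "\<sigma> \<in> \<J>" "\<tau> \<in> \<J>" "q \<sigma> = q \<tau>"
  shows "\<exists>t \<in> runits. \<tau> = act t \<sigma>"
  by (rule fibre_transitive[of \<sigma> \<tau>]) (use assms \<J>_iff in blast)+

lemma steinberg_zero_iff:
  assumes f: "f \<in> \<A>" and "\<sigma> \<in> \<J>" "\<tau> \<in> \<J>" "q \<sigma> = q \<tau>"
  shows "f \<sigma> = 0 \<longleftrightarrow> f \<tau> = 0"
proof -
  have "f \<tau>' = 0" if "f \<sigma>' = 0" "\<sigma>' \<in> \<J>" "\<tau>' \<in> \<J>" "q \<sigma>' = q \<tau>'" for \<sigma>' \<tau>'
  proof -
    have "\<exists>t \<in> runits. \<tau>' = act t \<sigma>'"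
      using \<J>_fibre_transitive that by blast
    then obtain t where t: "t \<in> runits" "\<tau>' = act t \<sigma>'" by blast
    then obtain u where "t * u = 1" by (auto simp: runits_iff)
    from steinbergD(2)[OF f that(2) this] show ?thesis using that(1) t(2) by simp
  qed
  from this[of \<sigma> \<tau>] this[of \<tau> \<sigma>] show ?thesis using assms by auto
qed

lemma in_image_support_iff:
  assumes "f \<in> \<A>" "\<sigma> \<in> \<J>"
  shows "q \<sigma> \<in> q ` supp f \<longleftrightarrow> f \<sigma> \<noteq> 0"
proof
  assume "q \<sigma> \<in> q ` supp f"
  then obtain \<tau> where "f \<tau> \<noteq> 0" "q \<sigma> = q \<tau>" by (auto simp: supp_def)
  then show "f \<sigma> \<noteq> 0" using steinberg_zero_iff[OF assms(1), of \<sigma> \<tau>] assms steinbergD(1)[OF assms(1)] by auto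
qed (auto simp: supp_def)

text \<open>Rescaling \<open>\<tau>\<close> by \<open>t\<close> multiplies the first factor by \<open>t\<inverse>\<close> and the second by \<open>t\<close>.\<close>

lemma convolution_term_invariant:
  assumes f: "f \<in> \<A>" and g: "g \<in> \<A>" and J: "\<tau> \<in> \<J>" "\<tau>' \<in> \<J>" "\<sigma> \<in> \<J>"
    and q: "q \<tau> = q \<tau>'" "rng G (q \<tau>) = rng G (q \<sigma>)"
  shows "f \<tau>' * g (gmult \<Sigma> (ginv \<Sigma> \<tau>') \<sigma>) = f \<tau> * g (gmult \<Sigma> (ginv \<Sigma> \<tau>) \<sigma>)"
proof -
  obtain t where t: "t \<in> runits" "\<tau>' = act t \<tau>"
    using \<J>_fibre_transitive J q by blast
  then obtain u where u: "t * u = 1" by (auto simp: runits_iff)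
  then have u': "u * t = 1" by (simp add: mult.commute)
  have "f \<tau>' = u * f \<tau>" using steinbergD(2)[OF f J(1) u] t by simp
  moreover have "g (gmult \<Sigma> (ginv \<Sigma> \<tau>') \<sigma>) = t * g (gmult \<Sigma> (ginv \<Sigma> \<tau>) \<sigma>)"
    using act_left_division[OF _ _ q(2) u] steinbergD(2)[OF g \<J>_left_division[OF J(1,3) q(2)] u'] J t
    by (simp add: \<J>_iff)
  ultimately show ?thesis using u' by (simp add: algebra_simps) (metis mult.assoc mult_1)
qed

text \<open>Independence of the choice of section gives freedom that later proofs exploit: the section can
  be made to pass through any given arrow, or be taken to be the section that defines the cocycle. The
  sum ranges over the part of a fibre of \<open>rng\<close> inside a compact set, so it is finite.\<close>

lemma convolution_eq_sum_over_section:
  assumes f: "f \<in> \<A>" and g: "g \<in> \<A>" and \<sigma>: "\<sigma> \<in> \<J>"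
    and S: "\<And>\<alpha>. \<alpha> \<in> \<I> \<Longrightarrow> rng G \<alpha> = rng G (q \<sigma>) \<Longrightarrow> S \<alpha> \<in> \<J> \<and> q (S \<alpha>) = \<alpha>"
  shows "(f \<star> g) \<sigma> = (\<Sum>\<alpha> \<in> {\<alpha> \<in> \<I>. rng G \<alpha> = rng G (q \<sigma>) \<and> f (S \<alpha>) \<noteq> 0}.
           f (S \<alpha>) * g (gmult \<Sigma> (ginv \<Sigma> (S \<alpha>)) \<sigma>))"
    and "finite {\<alpha> \<in> \<I>. rng G \<alpha> = rng G (q \<sigma>) \<and> f (S \<alpha>) \<noteq> 0}"
proof -
  let ?x = "rng G (q \<sigma>)"
  let ?T = "{\<alpha> \<in> \<I>. rng G \<alpha> = ?x \<and> f (S \<alpha>) \<noteq> 0}"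
  have T: "{\<alpha> \<in> \<I>. rng G \<alpha> = ?x} \<inter> q ` supp f = ?T"
  proof -
    have "\<alpha> \<in> q ` supp f \<longleftrightarrow> f (S \<alpha>) \<noteq> 0" if "\<alpha> \<in> \<I>" "rng G \<alpha> = ?x" for \<alpha>
      using in_image_support_iff[OF f, of "S \<alpha>"] S[OF that] by simp
    moreover have "q ` supp f \<subseteq> \<I>" by (rule steinbergD(4)[OF f])
    ultimately show ?thesis using G.isotropy_interior_arrows by auto
  qed
  have "(f \<star> g) \<sigma> = (\<Sum>\<alpha> \<in> ?T. f (inv_into (supp f) q \<alpha>) * g (gmult \<Sigma> (ginv \<Sigma> (inv_into (supp f) q \<alpha>)) \<sigma>))"
    using \<sigma> q_arrow(2)[of \<sigma>] by (simp add: steinberg_mult_def Let_def T \<J>_iff[of \<sigma>])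
  also have "\<dots> = (\<Sum>\<alpha> \<in> ?T. f (S \<alpha>) * g (gmult \<Sigma> (ginv \<Sigma> (S \<alpha>)) \<sigma>))"
  proof (rule sum.cong[OF refl])
    fix \<alpha> assume "\<alpha> \<in> ?T"
    then have "\<alpha> \<in> q ` supp f" and S\<alpha>: "S \<alpha> \<in> \<J>" "q (S \<alpha>) = \<alpha>" "rng G \<alpha> = ?x" using T S by blast+
    then have inv: "inv_into (supp f) q \<alpha> \<in> supp f" "q (inv_into (supp f) q \<alpha>) = \<alpha>"
      using inv_into_into[of \<alpha> q "supp f"] f_inv_into_f[of \<alpha> q "supp f"] by blast+
    then have "inv_into (supp f) q \<alpha> \<in> \<J>"
      using steinbergD(1)[OF f, of "inv_into (supp f) q \<alpha>"] by (simp add: supp_def)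
    with inv S\<alpha> \<sigma> show "f (inv_into (supp f) q \<alpha>) * g (gmult \<Sigma> (ginv \<Sigma> (inv_into (supp f) q \<alpha>)) \<sigma>) =
        f (S \<alpha>) * g (gmult \<Sigma> (ginv \<Sigma> (S \<alpha>)) \<sigma>)"
      by (intro convolution_term_invariant[OF f g]) (simp_all only:)
  qed
  finally show "(f \<star> g) \<sigma> = (\<Sum>\<alpha> \<in> ?T. f (S \<alpha>) * g (gmult \<Sigma> (ginv \<Sigma> (S \<alpha>)) \<sigma>))" .
  have "?T \<subseteq> {\<alpha> \<in> q ` supp f. rng G \<alpha> = ?x}" using T by blast
  then show "finite ?T"
    using G.finite_compact_fibre[OF steinbergD(3)[OF f]] finite_subset by blast
qed

lemma section_through:
  assumes "\<tau> \<in> \<J>"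
  obtains S where "\<And>\<alpha>. \<alpha> \<in> \<I> \<Longrightarrow> S \<alpha> \<in> \<J> \<and> q (S \<alpha>) = \<alpha>" "S (q \<tau>) = \<tau>"
proof -
  let ?S = "(\<lambda>\<alpha>. SOME \<sigma>. \<sigma> \<in> \<J> \<and> q \<sigma> = \<alpha>)(q \<tau> := \<tau>)"
  have "?S \<alpha> \<in> \<J> \<and> q (?S \<alpha>) = \<alpha>" if "\<alpha> \<in> \<I>" for \<alpha>
  proof -
    have "\<alpha> \<in> q ` arrows \<Sigma>" using that surj_q G.isotropy_interior_arrows by blast
    then have "\<exists>\<sigma>. \<sigma> \<in> \<J> \<and> q \<sigma> = \<alpha>" using that \<J>_iff by blast
    from someI_ex[OF this] show ?thesis using assms by auto
  qed
  then show thesis by (rule that[of ?S]) simp_all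
qed

lemma i_in_\<J>: "x \<in> units G \<Longrightarrow> t \<in> runits \<Longrightarrow> i (x, t) \<in> \<J>"
  using i_fibre G.units_in_isotropy_interior by (auto simp: \<J>_iff)

lemma diagonalD:
  assumes "b \<in> \<B>"
  shows "b \<in> \<A>" "b \<sigma> \<noteq> 0 \<Longrightarrow> q \<sigma> \<in> units G"
  using assms by (auto simp: diagonal_subalgebra_def supp_def units_isotropy_interior)

text \<open>For a factor supported over units, at most one summand of the convolution survives: the one
  at the unit \<open>rng (q \<sigma>)\<close> here, and the one at \<open>q \<sigma>\<close> in \<open>convolution_diagonal\<close>. A section through the
  unit, respectively through \<open>\<sigma>\<close>, makes this summand explicit.\<close>

lemma diagonal_convolution:
  assumes b: "b \<in> \<B>" and g: "g \<in> \<A>" and \<sigma>: "\<sigma> \<in> \<J>"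
  shows "(b \<star> g) \<sigma> = b (i (rng G (q \<sigma>), 1)) * g \<sigma>"
proof -
  let ?x = "rng G (q \<sigma>)" and ?\<iota> = "i (rng G (q \<sigma>), 1)"
  have \<sigma>\<Sigma>: "\<sigma> \<in> arrows \<Sigma>" using \<sigma> \<J>_iff by blast
  have x: "?x \<in> units G" using q_arrow[OF \<sigma>\<Sigma>] G.rng_in_units by blast
  note \<iota> = i_in_\<J>[OF x one_in_runits] i_fibre(2)[OF x one_in_runits]
  obtain S where S: "\<And>\<alpha>. \<alpha> \<in> \<I> \<Longrightarrow> S \<alpha> \<in> \<J> \<and> q (S \<alpha>) = \<alpha>" "S ?x = ?\<iota>"
    using section_through[OF \<iota>(1)] \<iota>(2) by metis
  let ?F = "\<lambda>\<alpha>. b (S \<alpha>) * g (gmult \<Sigma> (ginv \<Sigma> (S \<alpha>)) \<sigma>)"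
  let ?T = "{\<alpha> \<in> \<I>. rng G \<alpha> = ?x \<and> b (S \<alpha>) \<noteq> 0}"
  have "?T \<subseteq> {?x}"
  proof
    fix \<alpha> assume \<alpha>: "\<alpha> \<in> ?T"
    then have "\<alpha> \<in> units G" using diagonalD(2)[OF b] S(1) by force
    then show "\<alpha> \<in> {?x}" using \<alpha> G.unitsD by auto
  qed
  moreover have "?F \<alpha> = 0" if "\<alpha> \<in> {?x} - ?T" for \<alpha>
  proof -
    have "?x \<in> \<I>" "rng G ?x = ?x" using x G.units_in_isotropy_interior G.unitsD by auto
    then show ?thesis using that by auto
  qed
  ultimately have "sum ?F ?T = sum ?F {?x}"
    by (intro sum.mono_neutral_left) auto
  moreover have "(b \<star> g) \<sigma> = sum ?F ?T"
    using S(1) by (intro convolution_eq_sum_over_section[OF diagonalD(1)[OF b] g \<sigma>]) blast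
  moreover have "gmult \<Sigma> (ginv \<Sigma> ?\<iota>) \<sigma> = \<sigma>"
    using \<Sigma>.mult_inv_cancel_left[of "rng \<Sigma> \<sigma>" \<sigma>] \<sigma>\<Sigma>
    by (simp add: \<Sigma>.rng_closed \<Sigma>.src_rng \<Sigma>.rng_mult_left flip: rng_src_eq(1))
  ultimately show ?thesis using S(2) by simp
qed

lemma convolution_diagonal:
  assumes f: "f \<in> \<A>" and b: "b \<in> \<B>" and \<sigma>: "\<sigma> \<in> \<J>"
  shows "(f \<star> b) \<sigma> = f \<sigma> * b (i (src G (q \<sigma>), 1))"
proof -
  have \<sigma>\<Sigma>: "\<sigma> \<in> arrows \<Sigma>" and \<sigma>\<I>: "q \<sigma> \<in> \<I>" using \<sigma> \<J>_iff by blast+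
  obtain S where S: "\<And>\<alpha>. \<alpha> \<in> \<I> \<Longrightarrow> S \<alpha> \<in> \<J> \<and> q (S \<alpha>) = \<alpha>" "S (q \<sigma>) = \<sigma>"
    using section_through[OF \<sigma>] by metis
  let ?F = "\<lambda>\<alpha>. f (S \<alpha>) * b (gmult \<Sigma> (ginv \<Sigma> (S \<alpha>)) \<sigma>)"
  let ?T = "{\<alpha> \<in> \<I>. rng G \<alpha> = rng G (q \<sigma>) \<and> f (S \<alpha>) \<noteq> 0}"
  note sum = convolution_eq_sum_over_section[where S = S, OF f diagonalD(1)[OF b] \<sigma> S(1)]
  have zero: "?F \<alpha> = 0" if "\<alpha> \<in> ?T" "\<alpha> \<noteq> q \<sigma>" for \<alpha>
  proof (rule ccontr)
    assume "?F \<alpha> \<noteq> 0"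
    then have "q (gmult \<Sigma> (ginv \<Sigma> (S \<alpha>)) \<sigma>) \<in> units G"
      using diagonalD(2)[OF b] by (metis mult_zero_right)
    then have u: "gmult G (ginv G \<alpha>) (q \<sigma>) \<in> units G" (is "?u \<in> _")
      using q_left_division[of "S \<alpha>" \<sigma>] S(1)[of \<alpha>] that \<sigma>\<Sigma> by (simp add: \<J>_iff)
    have \<alpha>: "\<alpha> \<in> arrows G" "q \<sigma> \<in> arrows G" "rng G \<alpha> = rng G (q \<sigma>)"
      using that \<sigma>\<Sigma> q_arrow G.isotropy_interior_arrows by auto
    have "?u = src G \<alpha>" using G.unitsD(3)[OF u] G.left_division(2)[OF \<alpha>] by simp
    then have "\<alpha> = q \<sigma>"
      using G.mult_cancel_inv_left[OF \<alpha>] G.src_mult_right[OF \<alpha>(1)] by simp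
    then show False using that by simp
  qed
  have "(f \<star> b) \<sigma> = sum ?F ?T" using sum(1) .
  also have "\<dots> = sum ?F {q \<sigma>}"
  proof (rule sum.mono_neutral_cong)
    show "finite ?T" using sum(2) .
    \<comment> \<open>If \<open>q \<sigma>\<close> is not an index of the sum, then \<open>f \<sigma> = 0\<close>, and both sides are zero.\<close>
    show "?F \<alpha> = 0" if "\<alpha> \<in> {q \<sigma>} - ?T" for \<alpha>
      using that \<sigma>\<I> by auto
  qed (use zero in auto)
  also have "\<dots> = f \<sigma> * b (i (src G (q \<sigma>), 1))"
    using S(2) \<Sigma>.mult_inv_left[OF \<sigma>\<Sigma>] rng_src_eq(2)[OF \<sigma>\<Sigma>] by simp
  finally show ?thesis .
qed

section \<open>Indicator functions in the diagonal\<close>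

text \<open>The function whose value at a unit of \<open>K\<close> is \<open>1\<close>, extended to the scalars over \<open>K\<close> by
  equivariance; so its value at \<open>i (x, t)\<close> is the inverse of \<open>t\<close>.\<close>

definition diagonal_indicator :: "'g set \<Rightarrow> 's \<Rightarrow> 'r" where
  "diagonal_indicator K \<sigma> =
    (if \<sigma> \<in> arrows \<Sigma> \<and> q \<sigma> \<in> K then THE u. \<exists>t. \<sigma> = i (q \<sigma>, t) \<and> t * u = 1 else 0)"

lemma diagonal_indicator_i:
  assumes K: "K \<subseteq> units G" "x \<in> K" and tu: "t * u = 1"
  shows "diagonal_indicator K (i (x, t)) = u"
proof -
  have x: "x \<in> units G" and t: "t \<in> runits" using assms runitsI by blast+
  have "(THE u'. \<exists>t'. i (x, t) = i (x, t') \<and> t' * u' = 1) = u"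
  proof (rule the_equality)
    show "\<exists>t'. i (x, t) = i (x, t') \<and> t' * u = 1" using tu by blast
    fix u' assume "\<exists>t'. i (x, t) = i (x, t') \<and> t' * u' = 1"
    then obtain t' where t': "i (x, t) = i (x, t')" "t' * u' = 1" by blast
    then have "t = t'"
      using inj_onD[OF inj_i t'(1)] x t runitsI by blast
    then have "u' = (t * u) * u'" "u = (t * u') * u" using tu t'(2) by simp_all
    then show "u' = u" by (simp add: ac_simps)
  qed
  then show ?thesis
    using K(2) i_fibre[OF x t] by (simp add: diagonal_indicator_def)
qed

text \<open>The indicator is constant on each sheet \<open>i ` (K \<times> {t})\<close>, which is open by \<open>open_sheet\<close>, and it
  vanishes off the closed set over \<open>K\<close>.\<close>

lemma diagonal_indicator_in_diagonal:
  assumes K: "K \<subseteq> units G" "openin (gtop G) K" "closedin (gtop G) K" "compactin (gtop G) K"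
  shows "diagonal_indicator K \<in> \<B>"
proof -
  let ?b = "diagonal_indicator K"
  have zero: "?b \<sigma> = 0" if "q \<sigma> \<notin> K" for \<sigma>
    using that by (simp add: diagonal_indicator_def)
  have supp: "\<sigma> \<in> arrows \<Sigma> \<and> q \<sigma> \<in> K" if "?b \<sigma> \<noteq> 0" for \<sigma>
    using that by (auto simp: diagonal_indicator_def split: if_splits)
  have KI: "K \<subseteq> \<I>" using K(1) G.units_in_isotropy_interior by blast
  have "supp ?b \<subseteq> \<J>" using supp KI unfolding supp_def \<J>_iff subset_iff mem_Collect_eq by blast
  moreover have "\<exists>V. openin (gtop (isotropy_twist G \<Sigma> q)) V \<and> \<sigma> \<in> V \<and> (\<forall>\<tau>\<in>V. ?b \<tau> = ?b \<sigma>)"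
    if \<sigma>: "\<sigma> \<in> \<J>" for \<sigma>
  proof (cases "q \<sigma> \<in> K")
    case True
    have "\<sigma> \<in> arrows \<Sigma>" "q \<sigma> \<in> units G" using True \<sigma> K(1) by (auto simp: \<J>_iff)
    then obtain t where t: "t \<in> runits" "\<sigma> = i (q \<sigma>, t)" by (rule fibre_over_unit)
    obtain u where u: "t * u = 1" using t(1) by (auto simp: runits_iff)
    have val: "?b \<tau> = u" if "\<tau> \<in> i ` (K \<times> {t})" for \<tau>
      using that diagonal_indicator_i[OF K(1) _ u] by auto
    have "i ` (K \<times> {t}) \<subseteq> \<J>" using i_in_\<J> K(1) t(1) by auto
    then have "openin (gtop (isotropy_twist G \<Sigma> q)) (i ` (K \<times> {t}))"
      using open_sheet[OF K(2,1) t(1)] by (simp add: openin_isotropy_twist)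
    moreover have "\<sigma> \<in> i ` (K \<times> {t})" using True t(2) by blast
    moreover from this have "\<forall>\<tau> \<in> i ` (K \<times> {t}). ?b \<tau> = ?b \<sigma>" using val by metis
    ultimately show ?thesis by blast
  next
    case False
    let ?V = "{\<tau> \<in> arrows \<Sigma>. q \<tau> \<in> arrows G - K} \<inter> \<J>"
    have "openin (gtop \<Sigma>) {\<tau> \<in> arrows \<Sigma>. q \<tau> \<in> arrows G - K}"
      using continuous_q K(3) by (intro openin_continuous_map_preimage[of _ "gtop G"]) auto
    then have "openin (gtop (isotropy_twist G \<Sigma> q)) ?V"
      using \<J>_open by (simp add: openin_isotropy_twist openin_Int)
    moreover have "\<sigma> \<in> ?V" using \<sigma> False q_arrow(1)[of \<sigma>] by (simp add: \<J>_iff)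
    moreover have "\<forall>\<tau>\<in>?V. ?b \<tau> = ?b \<sigma>" using zero[of \<sigma>] False zero by simp
    ultimately show ?thesis by blast
  qed
  moreover have "?b (act t \<sigma>) = u * ?b \<sigma>" if \<sigma>: "\<sigma> \<in> \<J>" and tu: "t * u = 1" for \<sigma> t u
  proof (cases "q \<sigma> \<in> K")
    case True
    have T: "t \<in> runits" using tu runitsI by blast
    have "\<sigma> \<in> arrows \<Sigma>" "q \<sigma> \<in> units G" using True \<sigma> K(1) by (auto simp: \<J>_iff)
    then obtain t' where t': "t' \<in> runits" "\<sigma> = i (q \<sigma>, t')" by (rule fibre_over_unit)
    obtain u' where u': "t' * u' = 1" using t'(1) by (auto simp: runits_iff)
    have "(t * t') * (u * u') = (t * u) * (t' * u')" by (simp add: ac_simps)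
    then have tu': "(t * t') * (u * u') = 1" using tu u' by simp
    have "?b (act t (i (q \<sigma>, t'))) = u * u'"
      using act_i[OF \<open>q \<sigma> \<in> units G\<close> T t'(1)] diagonal_indicator_i[OF K(1) True tu'] by simp
    moreover have "?b (i (q \<sigma>, t')) = u'"
      by (rule diagonal_indicator_i[OF K(1) True u'])
    ultimately show ?thesis using t'(2) by simp
  next
    case False
    have "q (act t \<sigma>) = q \<sigma>" using \<sigma> tu runitsI act_arrow \<J>_iff by blast
    then show ?thesis using zero False by simp
  qed
  moreover have "compactin (gtop (isotropy_interior G)) (q ` supp ?b)"
    \<comment> \<open>Over the zero ring the support is empty; only otherwise does it lie over all of \<open>K\<close>.\<close>
  proof (cases "(1::'r) = 0")
    case True
    have "r = 0" for r :: 'r by (metis True mult_1 mult_zero_left)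
    then have "supp ?b = {}" by (auto simp: supp_def)
    then show ?thesis by simp
  next
    case False
    have "q ` supp ?b = K"
    proof
      show "K \<subseteq> q ` supp ?b"
      proof
        fix x assume x: "x \<in> K"
        then have "?b (i (x, 1)) = 1" by (intro diagonal_indicator_i[OF K(1)]) auto
        then have "i (x, 1) \<in> supp ?b" using False by (simp add: supp_def)
        moreover have "q (i (x, 1)) = x" using x K(1) i_fibre(2) one_in_runits by blast
        ultimately show "x \<in> q ` supp ?b" by (metis image_eqI)
      qed
    qed (use supp in \<open>auto simp: supp_def\<close>)
    then show ?thesis using K(4) KI by (simp add: compactin_isotropy)
  qed
  ultimately have "?b \<in> \<A>"
    by (simp add: steinberg_algebra_def)
  then show ?thesis
    using supp K(1) KI by (auto simp: diagonal_subalgebra_def supp_def units_isotropy_interior \<J>_iff)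
qed

text \<open>The ranges of the arrows in \<open>q ` supp n\<close>, which are also their sources, form a compact open set of
  units. Its indicator is a right identity for \<open>n\<close>, so inserting it between the factors shows that \<open>n \<star> k\<close> has the form \<open>n \<star> b \<star> k\<close>.\<close>

lemma local_right_identity:
  assumes H: "Hausdorff_space (gtop G)" and n: "n \<in> \<A>"
  obtains b where "b \<in> \<B>" "n \<star> b = n"
proof -
  let ?K = "rng G ` q ` supp n"
  have c: "compactin (gtop G) ?K"
    using image_compactin[OF steinbergD(3)[OF n] G.continuous_rng] .
  have "?K \<subseteq> units G"
    using steinbergD(4)[OF n] G.isotropy_interior_arrows G.rng_in_units by blast
  moreover have "openin (gtop G) ?K"
    using open_support[OF n] G.open_map_rng by (simp add: open_map_def)
  moreover have "closedin (gtop G) ?K" using compactin_imp_closedin[OF H c] .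
  ultimately have b: "diagonal_indicator ?K \<in> \<B>"
    using c by (intro diagonal_indicator_in_diagonal)
  have "(n \<star> diagonal_indicator ?K) \<sigma> = n \<sigma>" for \<sigma>
  proof (cases "\<sigma> \<in> \<J>")
    case True
    have "n \<sigma> * diagonal_indicator ?K (i (src G (q \<sigma>), 1)) = n \<sigma>"
    proof (cases "n \<sigma> = 0")
      case False
      then have "src G (q \<sigma>) \<in> ?K"
        using True G.isotropy_interior_rng[of "q \<sigma>"] by (force simp: \<J>_iff supp_def)
      then have "diagonal_indicator ?K (i (src G (q \<sigma>), 1)) = 1"
        using \<open>?K \<subseteq> units G\<close> by (intro diagonal_indicator_i) auto
      then show ?thesis by simp
    qed simp
    then show ?thesis using convolution_diagonal[OF n b True] by simp
  next
    case False
    then show ?thesis using steinbergD(1)[OF n] by (auto simp: steinberg_mult_def Let_def)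
  qed
  then show ?thesis using that b by blast
qed

section \<open>Evaluation in the twisted group ring of a fibre\<close>

lemma fibre_carrier:
  "\<alpha> \<in> carrier (fibre_group (isotropy_interior G) x) \<longleftrightarrow> \<alpha> \<in> \<I> \<and> src G \<alpha> = x"
  by (auto simp: fibre_group_def)

lemma fibre_inverse:
  assumes \<alpha>: "\<alpha> \<in> \<I>"
  shows "inv\<^bsub>fibre_group (isotropy_interior G) (src G \<alpha>)\<^esub> \<alpha> = ginv G \<alpha>"
proof -
  let ?x = "src G \<alpha>"
  have \<alpha>G: "\<alpha> \<in> arrows G" and r: "rng G \<alpha> = ?x"
    using \<alpha> G.isotropy_interior_arrows G.isotropy_interior_rng by auto
  have x: "?x \<in> units G" using \<alpha>G G.src_in_units by blast
  have "(THE y. y \<in> \<I> \<and> src G y = ?x \<and> gmult G \<alpha> y = ?x \<and> gmult G y \<alpha> = ?x) = ginv G \<alpha>"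
  proof (rule the_equality)
    have "gmult G (ginv G \<alpha>) ?x \<in> \<I>"
      using \<alpha> x r G.units_in_isotropy_interior G.unitsD(3)[OF x]
      by (intro G.isotropy_interior_left_division) auto
    moreover have "gmult G (ginv G \<alpha>) ?x = ginv G \<alpha>"
      using G.src_mult_right[OF G.inv_closed[OF \<alpha>G]] G.src_inv[OF \<alpha>G] r by simp
    ultimately show "ginv G \<alpha> \<in> \<I> \<and> src G (ginv G \<alpha>) = ?x \<and>
        gmult G \<alpha> (ginv G \<alpha>) = ?x \<and> gmult G (ginv G \<alpha>) \<alpha> = ?x"
      using \<alpha>G r G.src_inv G.mult_inv_right G.mult_inv_left by simp
    fix y assume y: "y \<in> \<I> \<and> src G y = ?x \<and> gmult G \<alpha> y = ?x \<and> gmult G y \<alpha> = ?x"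
    then have "y \<in> arrows G" "rng G y = ?x"
      using G.isotropy_interior_arrows G.isotropy_interior_rng by auto
    then have "gmult G (ginv G \<alpha>) (gmult G \<alpha> y) = y"
      using \<alpha>G by (intro G.mult_inv_cancel_left) auto
    then show "y = ginv G \<alpha>" using y \<open>gmult G (ginv G \<alpha>) ?x = ginv G \<alpha>\<close> by simp
  qed
  then show ?thesis
    by (simp add: m_inv_def fibre_group_def conj_assoc)
qed

definition fibre_evaluation :: "'g \<Rightarrow> ('g \<Rightarrow> 's) \<Rightarrow> ('s \<Rightarrow> 'r) \<Rightarrow> 'g \<Rightarrow> 'r" where
  "fibre_evaluation x \<zeta> f \<beta> = (if \<beta> \<in> carrier (fibre_group (isotropy_interior G) x) then f (\<zeta> \<beta>) else 0)"

context
  fixes x :: 'g and \<zeta> :: "'g \<Rightarrow> 's" and c :: "'g \<Rightarrow> 'g \<Rightarrow> 'r"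
  assumes x: "x \<in> units G"
    and \<zeta>: "unit_preserving_section (isotropy_interior G) (isotropy_twist G \<Sigma> q) i q x \<zeta>"
    and c: "cocycle_of_section (isotropy_interior G) (isotropy_twist G \<Sigma> q) i q x \<zeta> c"
begin

abbreviation "H \<equiv> fibre_group (isotropy_interior G) x"

lemma fibre_arrowD:
  assumes "\<alpha> \<in> carrier H"
  shows "\<alpha> \<in> \<I>" "\<alpha> \<in> arrows G" "src G \<alpha> = x" "rng G \<alpha> = x"
    "\<zeta> \<alpha> \<in> \<J>" "\<zeta> \<alpha> \<in> arrows \<Sigma>" "q (\<zeta> \<alpha>) = \<alpha>"
  using assms \<zeta> G.isotropy_interior_rng G.isotropy_interior_arrows
  by (auto simp: fibre_carrier unit_preserving_section_def \<J>_iff)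

lemma unit_in_H: "x \<in> carrier H"
  using x G.units_in_isotropy_interior G.unitsD by (auto simp: fibre_carrier)

lemma section_at_unit: "\<zeta> x = i (x, 1)"
  using \<zeta> by (simp add: unit_preserving_section_def)

lemma carrier_H: "\<alpha> \<in> carrier H \<longleftrightarrow> \<alpha> \<in> \<I> \<and> rng G \<alpha> = x"
  by (auto simp: fibre_carrier G.isotropy_interior_rng)

lemma section_on_range: "\<alpha> \<in> \<I> \<Longrightarrow> rng G \<alpha> = x \<Longrightarrow> \<zeta> \<alpha> \<in> \<J> \<and> q (\<zeta> \<alpha>) = \<alpha>"
  using fibre_arrowD(5,7) carrier_H by blast

lemma convolution_on_fibre:
  assumes f: "f \<in> \<A>" and g: "g \<in> \<A>" and \<beta>: "\<beta> \<in> carrier H"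
  shows "(f \<star> g) (\<zeta> \<beta>) = (\<Sum>\<alpha> \<in> {\<alpha> \<in> carrier H. f (\<zeta> \<alpha>) \<noteq> 0}.
      f (\<zeta> \<alpha>) * g (gmult \<Sigma> (ginv \<Sigma> (\<zeta> \<alpha>)) (\<zeta> \<beta>)))"
proof -
  have "rng G (q (\<zeta> \<beta>)) = x" using fibre_arrowD[OF \<beta>] by simp
  then show ?thesis
    using convolution_eq_sum_over_section(1)[OF f g fibre_arrowD(5)[OF \<beta>], of \<zeta>] section_on_range
    by (simp add: carrier_H conj_assoc)
qed

lemma fibre_evaluation_in_carrier:
  assumes f: "f \<in> \<A>"
  shows "fibre_evaluation x \<zeta> f \<in> carrier (twisted_group_ring H c)"
proof -
  have r: "rng G (q (\<zeta> x)) = x" using fibre_arrowD[OF unit_in_H] by simp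
  have "finite {\<alpha> \<in> \<I>. rng G \<alpha> = rng G (q (\<zeta> x)) \<and> f (\<zeta> \<alpha>) \<noteq> 0}"
    using fibre_arrowD(5)[OF unit_in_H] section_on_range r
    by (intro convolution_eq_sum_over_section(2)[OF f f]) auto
  moreover have "{\<alpha>. fibre_evaluation x \<zeta> f \<alpha> \<noteq> 0} =
      {\<alpha> \<in> \<I>. rng G \<alpha> = rng G (q (\<zeta> x)) \<and> f (\<zeta> \<alpha>) \<noteq> 0}"
    by (auto simp: fibre_evaluation_def carrier_H r)
  ultimately have "finite {\<alpha>. fibre_evaluation x \<zeta> f \<alpha> \<noteq> 0}" by simp
  moreover have "{\<alpha>. fibre_evaluation x \<zeta> f \<alpha> \<noteq> 0} \<subseteq> carrier H"
    by (auto simp: fibre_evaluation_def)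
  ultimately show ?thesis by (simp add: twisted_group_ring_def)
qed

text \<open>From \<open>\<zeta> \<alpha> \<zeta> \<gamma> = c \<alpha> \<gamma> \<cdot> \<zeta> \<beta>\<close> with \<open>\<gamma> = \<alpha>\<inverse> \<beta>\<close>, the arrow \<open>\<zeta> \<gamma>\<close> is \<open>(\<zeta> \<alpha>)\<inverse> \<zeta> \<beta>\<close>
  rescaled by \<open>c \<alpha> \<gamma>\<close>, and equivariance turns the scalar into its inverse.\<close>

lemma cocycle_factor:
  assumes g: "g \<in> \<A>" and \<alpha>: "\<alpha> \<in> carrier H" and \<beta>: "\<beta> \<in> carrier H"
  defines "\<gamma> \<equiv> gmult G (ginv G \<alpha>) \<beta>"
  shows "\<gamma> \<in> carrier H" "g (gmult \<Sigma> (ginv \<Sigma> (\<zeta> \<alpha>)) (\<zeta> \<beta>)) = c \<alpha> \<gamma> * g (\<zeta> \<gamma>)"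
proof -
  note a = fibre_arrowD[OF \<alpha>] and b = fibre_arrowD[OF \<beta>]
  show \<gamma>: "\<gamma> \<in> carrier H"
    using a b G.isotropy_interior_left_division[of \<alpha> \<beta>] G.left_division[of \<alpha> \<beta>]
    by (simp add: fibre_carrier \<gamma>_def)
  note g' = fibre_arrowD[OF \<gamma>]
  have "c \<alpha> \<gamma> \<in> runits" and "gmult \<Sigma> (\<zeta> \<alpha>) (\<zeta> \<gamma>) = act (c \<alpha> \<gamma>) (\<zeta> (gmult G \<alpha> \<gamma>))"
    using c \<alpha> \<gamma> by (simp_all add: cocycle_of_section_def)
  moreover have "gmult G \<alpha> \<gamma> = \<beta>"
    unfolding \<gamma>_def using a b by (intro G.mult_cancel_inv_left) simp_all
  ultimately have t: "c \<alpha> \<gamma> \<in> runits" and mult: "gmult \<Sigma> (\<zeta> \<alpha>) (\<zeta> \<gamma>) = act (c \<alpha> \<gamma>) (\<zeta> \<beta>)"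
    by simp_all
  obtain u where tu: "c \<alpha> \<gamma> * u = 1" using t by (auto simp: runits_iff)
  then have ut: "u * c \<alpha> \<gamma> = 1" and u: "u \<in> runits" using runitsI by (auto simp: mult.commute)
  have comp: "(\<zeta> \<alpha>, \<zeta> \<gamma>) \<in> composable \<Sigma>"
    using a g' rng_src_eq by (simp add: composable_def)
  have act\<alpha>: "act u (\<zeta> \<alpha>) \<in> arrows \<Sigma>" "q (act u (\<zeta> \<alpha>)) = \<alpha>"
    using act_arrow a u by simp_all
  have "gmult \<Sigma> (act u (\<zeta> \<alpha>)) (\<zeta> \<gamma>) = act u (act (c \<alpha> \<gamma>) (\<zeta> \<beta>))"
    using act_mult[OF comp u] mult by simp
  also have "\<dots> = \<zeta> \<beta>"
    using act_act[OF b(6) u t] act_one[OF b(6)] ut by simp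
  finally have "gmult \<Sigma> (ginv \<Sigma> (act u (\<zeta> \<alpha>))) (\<zeta> \<beta>) = \<zeta> \<gamma>"
    using \<Sigma>.mult_inv_cancel_left[of "act u (\<zeta> \<alpha>)" "\<zeta> \<gamma>"] act\<alpha> a g' rng_src_eq by simp
  moreover have "gmult \<Sigma> (ginv \<Sigma> (act u (\<zeta> \<alpha>))) (\<zeta> \<beta>) =
      act (c \<alpha> \<gamma>) (gmult \<Sigma> (ginv \<Sigma> (\<zeta> \<alpha>)) (\<zeta> \<beta>))"
    using a b by (intro act_left_division ut) simp_all
  moreover have "gmult \<Sigma> (ginv \<Sigma> (\<zeta> \<alpha>)) (\<zeta> \<beta>) \<in> \<J>"
    using a b by (intro \<J>_left_division) simp_all
  ultimately have "g (\<zeta> \<gamma>) = u * g (gmult \<Sigma> (ginv \<Sigma> (\<zeta> \<alpha>)) (\<zeta> \<beta>))"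
    using steinbergD(2)[OF g _ tu] by metis
  then have "c \<alpha> \<gamma> * g (\<zeta> \<gamma>) = (c \<alpha> \<gamma> * u) * g (gmult \<Sigma> (ginv \<Sigma> (\<zeta> \<alpha>)) (\<zeta> \<beta>))"
    by (simp only: mult.assoc)
  then show "g (gmult \<Sigma> (ginv \<Sigma> (\<zeta> \<alpha>)) (\<zeta> \<beta>)) = c \<alpha> \<gamma> * g (\<zeta> \<gamma>)"
    using tu by simp
qed

lemma fibre_evaluation_mult:
  assumes f: "f \<in> \<A>" and g: "g \<in> \<A>"
  shows "fibre_evaluation x \<zeta> f \<otimes>\<^bsub>twisted_group_ring H c\<^esub> fibre_evaluation x \<zeta> g =
    fibre_evaluation x \<zeta> (f \<star> g)"
proof
  fix \<beta>
  let ?e = "fibre_evaluation x \<zeta>"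
  show "(?e f \<otimes>\<^bsub>twisted_group_ring H c\<^esub> ?e g) \<beta> = ?e (f \<star> g) \<beta>"
  proof (cases "\<beta> \<in> carrier H")
    case \<beta>: True
    have "(?e f \<otimes>\<^bsub>twisted_group_ring H c\<^esub> ?e g) \<beta> = (\<Sum>\<alpha> \<in> {\<alpha> \<in> carrier H. ?e f \<alpha> \<noteq> 0}.
        c \<alpha> (inv\<^bsub>H\<^esub> \<alpha> \<otimes>\<^bsub>H\<^esub> \<beta>) * ?e f \<alpha> * ?e g (inv\<^bsub>H\<^esub> \<alpha> \<otimes>\<^bsub>H\<^esub> \<beta>))"
      using \<beta> by (simp add: twisted_group_ring_def)
    also have "\<dots> = (\<Sum>\<alpha> \<in> {\<alpha> \<in> carrier H. f (\<zeta> \<alpha>) \<noteq> 0}.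
        f (\<zeta> \<alpha>) * g (gmult \<Sigma> (ginv \<Sigma> (\<zeta> \<alpha>)) (\<zeta> \<beta>)))"
    proof (rule sum.cong)
      show "{\<alpha> \<in> carrier H. ?e f \<alpha> \<noteq> 0} = {\<alpha> \<in> carrier H. f (\<zeta> \<alpha>) \<noteq> 0}"
        by (auto simp: fibre_evaluation_def)
      fix \<alpha> assume "\<alpha> \<in> {\<alpha> \<in> carrier H. f (\<zeta> \<alpha>) \<noteq> 0}"
      then have \<alpha>: "\<alpha> \<in> carrier H" by simp
      have inv: "inv\<^bsub>H\<^esub> \<alpha> \<otimes>\<^bsub>H\<^esub> \<beta> = gmult G (ginv G \<alpha>) \<beta>"
        using fibre_inverse[of \<alpha>] fibre_arrowD[OF \<alpha>] by (simp add: fibre_group_def)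
      show "c \<alpha> (inv\<^bsub>H\<^esub> \<alpha> \<otimes>\<^bsub>H\<^esub> \<beta>) * ?e f \<alpha> * ?e g (inv\<^bsub>H\<^esub> \<alpha> \<otimes>\<^bsub>H\<^esub> \<beta>) =
          f (\<zeta> \<alpha>) * g (gmult \<Sigma> (ginv \<Sigma> (\<zeta> \<alpha>)) (\<zeta> \<beta>))"
        unfolding inv cocycle_factor(2)[OF g \<alpha> \<beta>]
        using \<alpha> cocycle_factor(1)[OF g \<alpha> \<beta>] by (simp add: fibre_evaluation_def ac_simps)
    qed
    also have "\<dots> = ?e (f \<star> g) \<beta>"
      using convolution_on_fibre[OF f g \<beta>] \<beta> by (simp add: fibre_evaluation_def)
    finally show ?thesis .
  next
    case False
    then show ?thesis by (simp add: twisted_group_ring_def fibre_evaluation_def)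
  qed
qed

lemma fibre_evaluation_diagonal:
  assumes b: "b \<in> \<B>"
  shows "fibre_evaluation x \<zeta> b = point_mass x (b (i (x, 1)))"
proof
  fix \<beta>
  have "b (\<zeta> \<beta>) = 0" if "\<beta> \<in> carrier H" "\<beta> \<noteq> x"
  proof (rule ccontr)
    assume "b (\<zeta> \<beta>) \<noteq> 0"
    then have "\<beta> \<in> units G" using diagonalD(2)[OF b] fibre_arrowD(7)[OF that(1)] by metis
    then show False using that G.unitsD fibre_arrowD(3) by metis
  qed
  then show "fibre_evaluation x \<zeta> b \<beta> = point_mass x (b (i (x, 1))) \<beta>"
    using unit_in_H section_at_unit by (auto simp: fibre_evaluation_def point_mass_def)
qed

lemma diagonal_identity_on_fibre:
  assumes b: "b \<in> \<B>" and f: "f \<in> \<A>" and bf: "b \<star> f = f" and \<alpha>: "\<alpha> \<in> carrier H"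
  shows "b (i (x, 1)) * f (\<zeta> \<alpha>) = f (\<zeta> \<alpha>)"
  using diagonal_convolution[OF b f fibre_arrowD(5)[OF \<alpha>]] bf fibre_arrowD[OF \<alpha>] by simp

text \<open>Write \<open>a\<close> as a sum of terms \<open>n (\<zeta> \<alpha>) * k (\<dots>)\<close>. As \<open>n \<star> k\<close> is diagonal, \<open>(n \<star> k) \<star> n = n\<close> says that \<open>a\<close>
  fixes every \<open>n (\<zeta> \<alpha>)\<close>, hence every term, hence \<open>a\<close>.\<close>

lemma diagonal_product_idempotent:
  assumes n: "n \<in> \<A>" and k: "k \<in> \<A>" and nk: "n \<star> k \<in> \<B>" "(n \<star> k) \<star> n = n"
  defines "a \<equiv> (n \<star> k) (i (x, 1))"
  shows "a * a = a"
proof -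
  have sum: "a = (\<Sum>\<alpha> \<in> {\<alpha> \<in> carrier H. n (\<zeta> \<alpha>) \<noteq> 0}.
      n (\<zeta> \<alpha>) * k (gmult \<Sigma> (ginv \<Sigma> (\<zeta> \<alpha>)) (\<zeta> x)))" (is "_ = sum ?F ?T")
    using convolution_on_fibre[OF n k unit_in_H] section_at_unit by (simp add: a_def)
  have "a * a = (\<Sum>\<alpha> \<in> ?T. a * ?F \<alpha>)"
    by (subst (2) sum) (simp add: sum_distrib_left)
  also have "\<dots> = sum ?F ?T"
  proof (rule sum.cong[OF refl])
    fix \<alpha> assume "\<alpha> \<in> ?T"
    then have "a * n (\<zeta> \<alpha>) = n (\<zeta> \<alpha>)"
      unfolding a_def using diagonal_identity_on_fibre[OF nk(1) n nk(2)] by simp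
    then show "a * ?F \<alpha> = ?F \<alpha>" by (simp flip: mult.assoc)
  qed
  finally show ?thesis using sum by simp
qed

text \<open>The values of \<open>n \<star> k\<close> and \<open>k \<star> n\<close> at the unit are idempotent. If both are \<open>1\<close>, then the evaluations of
  \<open>n\<close> and \<open>k\<close> are mutually inverse. If that of \<open>n \<star> k\<close> is \<open>0\<close>, then \<open>n = (n \<star> k) \<star> n\<close> vanishes on the fibre; and
  if that of \<open>k \<star> n\<close> is \<open>0\<close>, then \<open>k\<close> vanishes there, which brings back the previous case.\<close>

lemma normaliser_fibre_dichotomy:
  assumes indecomposable: "\<forall>e::'r. e * e = e \<longrightarrow> e = 0 \<or> e = 1"
    and n: "n \<in> \<A>" and k: "k \<in> \<A>"
    and nk: "n \<star> k \<in> \<B>" "(n \<star> k) \<star> n = n" and kn: "k \<star> n \<in> \<B>" "(k \<star> n) \<star> k = k"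
  shows "(\<forall>\<alpha> \<in> carrier H. n (\<zeta> \<alpha>) = 0) \<or>
    fibre_evaluation x \<zeta> n \<in> Units (twisted_group_ring H c)"
proof -
  let ?a = "(n \<star> k) (i (x, 1))" and ?a' = "(k \<star> n) (i (x, 1))"
  have idem: "?a = 0 \<or> ?a = 1" "?a' = 0 \<or> ?a' = 1"
    using indecomposable diagonal_product_idempotent[OF n k nk]
      diagonal_product_idempotent[OF k n kn] by blast+
  note n_id = diagonal_identity_on_fibre[OF nk(1) n nk(2)]
  note k_id = diagonal_identity_on_fibre[OF kn(1) k kn(2)]
  show ?thesis
  proof (cases "?a = 0 \<or> ?a' = 0")
    case True
    have "\<forall>\<alpha> \<in> carrier H. n (\<zeta> \<alpha>) = 0" if "?a = 0"
      using n_id that by simp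
    moreover have "?a = 0" if a': "?a' = 0"
    proof -
      have zero: "k (\<zeta> \<alpha>) = 0" if "\<alpha> \<in> carrier H" for \<alpha> using k_id[OF that] a' by simp
      have "k (gmult \<Sigma> (ginv \<Sigma> (\<zeta> \<alpha>)) (\<zeta> x)) = 0" if "\<alpha> \<in> carrier H" for \<alpha>
        using cocycle_factor[OF k that unit_in_H] zero by simp
      then have "(n \<star> k) (\<zeta> x) = 0"
        using convolution_on_fibre[OF n k unit_in_H] by simp
      then show ?thesis using section_at_unit by simp
    qed
    ultimately show ?thesis using True by blast
  next
    case False
    let ?R = "twisted_group_ring H c" and ?e = "fibre_evaluation x \<zeta>"
    have one: "\<one>\<^bsub>?R\<^esub> = point_mass x 1"
      by (simp add: twisted_group_ring_def fibre_group_def)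
    have "?e n \<otimes>\<^bsub>?R\<^esub> ?e k = \<one>\<^bsub>?R\<^esub>" "?e k \<otimes>\<^bsub>?R\<^esub> ?e n = \<one>\<^bsub>?R\<^esub>"
      using False idem fibre_evaluation_mult fibre_evaluation_diagonal n k nk(1) kn(1) one by simp_all
    then have "?e n \<in> Units ?R"
      using fibre_evaluation_in_carrier n k unfolding Units_def by blast
    then show ?thesis ..
  qed
qed

lemma normaliser_support_in_fibre:
  assumes indecomposable: "\<forall>e::'r. e * e = e \<longrightarrow> e = 0 \<or> e = 1"
    and units: "Units (twisted_group_ring H c) =
      {point_mass \<alpha> t |t \<alpha>. t \<in> runits \<and> \<alpha> \<in> carrier H}"
    and n: "n \<in> \<A>" and k: "k \<in> \<A>"
    and nk: "n \<star> k \<in> \<B>" "(n \<star> k) \<star> n = n" and kn: "k \<star> n \<in> \<B>" "(k \<star> n) \<star> k = k"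
    and \<alpha>: "\<alpha> \<in> q ` supp n" "rng G \<alpha> = x" and \<beta>: "\<beta> \<in> q ` supp n" "rng G \<beta> = x"
  shows "\<alpha> = \<beta>"
proof -
  have H: "\<alpha> \<in> carrier H" "\<beta> \<in> carrier H"
    using \<alpha> \<beta> steinbergD(4)[OF n] by (auto simp: carrier_H)
  then have nz: "n (\<zeta> \<alpha>) \<noteq> 0" "n (\<zeta> \<beta>) \<noteq> 0"
    using in_image_support_iff[OF n] fibre_arrowD \<alpha> \<beta> by metis+
  then have "fibre_evaluation x \<zeta> n \<in> Units (twisted_group_ring H c)"
    using normaliser_fibre_dichotomy[OF indecomposable n k nk kn] H by blast
  then obtain \<gamma> t where "fibre_evaluation x \<zeta> n = point_mass \<gamma> t" using units by auto
  then have "fibre_evaluation x \<zeta> n \<delta> \<noteq> 0 \<Longrightarrow> \<delta> = \<gamma>" for \<delta>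
    by (simp add: point_mass_def split: if_splits)
  then show ?thesis using nz H by (metis fibre_evaluation_def)
qed

end

section \<open>Normalisers and bisections\<close>

lemma normaliserE:
  assumes H: "Hausdorff_space (gtop G)"
    and n: "normaliser (isotropy_interior G) (isotropy_twist G \<Sigma> q) i q n"
  obtains k where "n \<in> \<A>" "k \<in> \<A>" "n \<star> k \<in> \<B>" "(n \<star> k) \<star> n = n" "k \<star> n \<in> \<B>" "(k \<star> n) \<star> k = k"
proof -
  obtain k where n: "n \<in> \<A>" and k: "k \<in> \<A>" "(k \<star> n) \<star> k = k" "(n \<star> k) \<star> n = n"
    and B: "\<forall>b\<in>\<B>. (k \<star> b) \<star> n \<in> \<B> \<and> (n \<star> b) \<star> k \<in> \<B>"
    using n unfolding normaliser_def Let_def by (elim conjE bexE)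
  obtain b where "b \<in> \<B>" "n \<star> b = n" using local_right_identity[OF H n] by blast
  moreover obtain b' where "b' \<in> \<B>" "k \<star> b' = k" using local_right_identity[OF H k(1)] by blast
  ultimately have "n \<star> k \<in> \<B>" "k \<star> n \<in> \<B>" using B by force+
  then show ?thesis using that n k by blast
qed

end

text \<open>Two arrows of \<open>q ` supp n\<close> with the same range have disjoint neighbourhoods inside the open set
  \<open>q ` supp n\<close>. The ranges of these neighbourhoods overlap in an open set of units, and at a unit of the
  dense set in this overlap the support would contain two arrows.\<close>

theorem lemma4p6:
  fixes G :: "'g tgroupoid" and \<Sigma> :: "'s tgroupoid"
    and i :: "'g \<times> 'r::comm_ring_1 \<Rightarrow> 's" and q :: "'s \<Rightarrow> 'g"
    and \<zeta> :: "'g \<Rightarrow> 'g \<Rightarrow> 's" and c :: "'g \<Rightarrow> 'g \<Rightarrow> 'g \<Rightarrow> 'r"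
  assumes indecomposable: "\<forall>e::'r. e * e = e \<longrightarrow> e = 0 \<or> e = 1"
    and ample: "ample_groupoid G" and Hausdorff: "Hausdorff_space (gtop G)"
    and twist: "discrete_twist G \<Sigma> i q"
    and section_zeta: "\<forall>x\<in>units G.
      unit_preserving_section (isotropy_interior G) (isotropy_twist G \<Sigma> q) i q x (\<zeta> x)"
    and cocycle: "\<forall>x\<in>units G.
      cocycle_of_section (isotropy_interior G) (isotropy_twist G \<Sigma> q) i q x (\<zeta> x) (c x)"
    and dense: "unit_space G closure_of
      {x \<in> units G. Units (twisted_group_ring (fibre_group (isotropy_interior G) x) (c x)) =
         {point_mass \<alpha> t |t \<alpha>. t \<in> runits \<and> \<alpha> \<in> carrier (fibre_group (isotropy_interior G) x)}}
      = topspace (unit_space G)"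
  shows "local_bisection_hypothesis (isotropy_interior G) (isotropy_twist G \<Sigma> q) i q"
proof -
  interpret discrete_twist G \<Sigma> i q by (rule twist)
  let ?X = "{x \<in> units G. Units (twisted_group_ring (fibre_group (isotropy_interior G) x) (c x)) =
         {point_mass \<alpha> t |t \<alpha>. t \<in> runits \<and> \<alpha> \<in> carrier (fibre_group (isotropy_interior G) x)}}"
  have "bisection (isotropy_interior G) (q ` supp n)"
    if norm: "normaliser (isotropy_interior G) (isotropy_twist G \<Sigma> q) i q n" for n
  proof (rule G.bisection_isotropy_interior)
    obtain k where n: "n \<in> \<A>" and k: "k \<in> \<A>" "n \<star> k \<in> \<B>" "(n \<star> k) \<star> n = n"
      "k \<star> n \<in> \<B>" "(k \<star> n) \<star> k = k"
      by (rule normaliserE[OF Hausdorff norm])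
    let ?S = "q ` supp n"
    show openS: "openin (gtop G) ?S" by (rule open_support[OF n])
    show SI: "?S \<subseteq> arrows (isotropy_interior G)" by (rule steinbergD(4)[OF n])
    have fibre: "\<alpha> = \<beta>" if "y \<in> ?X" "\<alpha> \<in> ?S" "rng G \<alpha> = y" "\<beta> \<in> ?S" "rng G \<beta> = y" for y \<alpha> \<beta>
      using that section_zeta cocycle
      by (intro normaliser_support_in_fibre[of y "\<zeta> y" "c y" n k \<alpha> \<beta>] indecomposable n k) simp_all
    show "inj_on (rng G) ?S"
    proof (rule inj_onI, rule ccontr)
      fix \<alpha> \<beta> assume \<alpha>\<beta>: "\<alpha> \<in> ?S" "\<beta> \<in> ?S" "rng G \<alpha> = rng G \<beta>" "\<alpha> \<noteq> \<beta>"
      have arr: "\<alpha> \<in> arrows G" "\<beta> \<in> arrows G"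
        using \<alpha>\<beta> SI G.isotropy_interior_arrows by blast+
      obtain U V where UV: "openin (gtop G) U" "openin (gtop G) V" "\<alpha> \<in> U" "\<beta> \<in> V" "disjnt U V"
        using Hausdorff arr \<alpha>\<beta>(4) unfolding Hausdorff_space_def by blast
      let ?W = "rng G ` (U \<inter> ?S) \<inter> rng G ` (V \<inter> ?S)"
      have "openin (unit_space G) ?W"
        using G.open_map_rng_unit_space UV openS by (simp add: open_map_def openin_Int)
      moreover have "rng G \<alpha> \<in> ?W"
      proof
        show "rng G \<alpha> \<in> rng G ` (U \<inter> ?S)" using \<alpha>\<beta>(1) UV(3) by blast
        show "rng G \<alpha> \<in> rng G ` (V \<inter> ?S)" unfolding \<alpha>\<beta>(3) using \<alpha>\<beta>(2) UV(4) by blast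
      qed
      moreover have "rng G \<alpha> \<in> unit_space G closure_of ?X"
        unfolding dense using arr G.rng_in_units G.rng_closed by (simp add: unit_space_def)
      ultimately have "\<exists>y. y \<in> ?X \<and> y \<in> ?W"
        by (simp only: in_closure_of)
      then obtain y where y: "y \<in> ?X" "y \<in> rng G ` (U \<inter> ?S)" "y \<in> rng G ` (V \<inter> ?S)"
        by (elim exE conjE IntE)
      obtain \<alpha>' where a: "\<alpha>' \<in> U" "\<alpha>' \<in> ?S" "rng G \<alpha>' = y" using y(2) by (elim imageE IntE) simp
      obtain \<beta>' where b: "\<beta>' \<in> V" "\<beta>' \<in> ?S" "rng G \<beta>' = y" using y(3) by (elim imageE IntE) simp
      have "\<alpha>' = \<beta>'" by (rule fibre[OF y(1) a(2,3) b(2,3)])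
      then show False using a(1) b(1) UV(5) by (simp add: disjnt_iff)
    qed
  qed
  then show ?thesis by (simp add: local_bisection_hypothesis_def)
qed

end
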